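(* Let $G$ be a topological group acting on $\mathcal{X}^n$, let $\{\mathbf{P}_g\}_{g\in G}$ and $\{\mathbf{Q}_g\}_{g\in G}$ be two families of probability distributions on $\mathcal{X}^n$, and let $M_n=m_n(X^n)$ be a maximally invariant statistic under the action of $G$ on $\mathcal{X}^n$. Assume that $G$ is amenable, that the following three properties hold: (1) as topological spaces, $G$ and $\mathcal{X}^n$ are Polish and locally compact (separable, completely metrizable and locally compact), equipped with their Borel $\sigma$-algebras; (2) the action of $G$ on $\mathcal{X}^n$ is free, continuous and proper; (3) the models $\{\mathbf{P}_g\}_{g\in G}$ and $\{\mathbf{Q}_g\}_{g\in G}$ are invariant and have densities $p_g,q_g$ with respect to a common measure $\mu$ on $\mathcal{X}^n$ that is relatively left invariant with some multiplier $\chi$, and all densities have a single common support; and that there is $\varepsilon>0$ such that $$\mathbf{E}^{\mathbf{Q}}_1\left[\left|\ln\frac{q_1(X^n)}{p_1(X^n)}\right|^{1+\varepsilon}\right]<\infty\quad\text{and}\quad \mathbf{E}^{\mathbf{Q}^{M_n}}\left[\left|\ln\frac{q^{M_n}(M_n)}{p^{M_n}(M_n)}\right|^{1+\varepsilon}\right]<\infty,$$ where the subindex $1$ refers to the unit element of $G$. Then $$\inf_{\mathbf{\Pi}_0,\mathbf{\Pi}_1}\mathrm{KL}\left(\mathbf{\Pi}_1^g\mathbf{Q}_g,\ \mathbf{\Pi}_0^g\mathbf{P}_g\right)=\mathrm{KL}\left(\mathbf{Q}^{M_n},\mathbf{P}^{M_n}\right),$$ where the infimum is over all pairs $(\mathbf{\Pi}_0,\mathbf{\Pi}_1)$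 of probability distributions on $G$.
   Context: $G$ acts on the observation space $\mathcal{X}$ and on $\mathcal{X}^n$ componentwise, $g(x_1,\dots,x_n)=(gx_1,\dots,gx_n)$. $X^n=(X_1,\dots,X_n)$ is the data, with values in $\mathcal{X}^n$; $\mathbf{E}^{\mathbf{P}}_g,\mathbf{E}^{\mathbf{Q}}_g$ are the expectations when $X^n$ has distribution $\mathbf{P}_g$, $\mathbf{Q}_g$. Statistics are measurable functions of the data, with values in any set equipped with a $\sigma$-algebra. Invariance: $\{\mathbf{P}_g\}_{g\in G}$ is invariant if $\mathbf{P}_{hg}\{X^n\in hB\}=\mathbf{P}_g\{X^n\in B\}$ for all $g,h\in G$ and measurable $B\subseteq\mathcal{X}^n$; similarly for $\{\mathbf{Q}_g\}$. Relatively left invariant with multiplier $\chi$: $\mu\{gB\}=\chi(g)\mu\{B\}$ for any measurable $B\subseteq\mathcal{X}^n$ and $g\in G$. Single common support: the densities $p_g,q_g$ are positive on one and the same set. Free action: $gx=x$ for some $x$ implies $g$ is the identity. Proper action: the map $(g,x)\mapsto(gx,x)$ from $G\times\mathcal{X}^n$ to $\mathcal{X}^n\times\mathcal{X}^n$ has compact preimages of compact sets. Maximally invariant: $m_n(x)=m_n(x')$ if and only if there is $g\in G$ with $x=gx'$. By invariance of the models, the distribution of $M_n$ under $\mathbf{P}_g$ (resp. $\mathbf{Q}_g$) does not depend on $g$; it is denoted $\mathbf{P}^{M_n}$ (resp. $\mathbf{Q}^{M_n}$), with density $p^{M_n}$ (resp. $q^{M_n}$) with respect to a common dominating measure. Mixtures: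 for a probability distribution $\mathbf{\Pi}$ on $G$, $\mathbf{\Pi}^g\mathbf{P}_g$ is the distribution $B\mapsto\int\mathbf{P}_g\{X^n\in B\}\,\mathrm{d}\mathbf{\Pi}(g)$; similarly for $\mathbf{Q}$. $\mathrm{KL}(\mathbf{Q},\mathbf{P})=\mathbf{E}^{\mathbf{Q}}[\ln(\mathrm{d}\mathbf{Q}/\mathrm{d}\mathbf{P})]$ is the Kullback-Leibler divergence. Amenability: $G$ is amenable if there is a sequence $\mathbf{\Pi}_1,\mathbf{\Pi}_2,\dots$ of probability distributions on $G$ such that $\lim_{k\to\infty}|\mathbf{\Pi}_k\{B\}-\mathbf{\Pi}_k\{Bg\}|=0$ for every measurable $B\subseteq G$ and every $g\in G$.
   Formalization: Added assumption: every invariant Borel event is {M_n ∈ A} for a measurable A in the value space of M_n. Without it the claim fails (trivial group, identity into ℝ with trivial σ-algebra, N(0,1) vs N(1,1)). It is automatic for standard Borel value spaces and for the quotient σ-algebra. *)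

theory Defs
  imports "HOL-Probability.Probability"
begin

text \<open>
  Topological groups are rendered by the class \<open>topological_group_add\<close>: despite the additive
  notation it does not include commutativity. The product of \<open>g\<close> and \<open>h\<close> is \<open>g + h\<close>, the unit
  is \<open>0\<close>, the inverse is \<open>- g\<close>.

  The space of samples of size \<open>n\<close> is the type \<open>'n \<Rightarrow> 'x\<close> with \<open>'n\<close> finite of cardinality
  \<open>n\<close>; its topology is the product topology.
\<close>

definition is_action :: "('g::group_add \<Rightarrow> 'x \<Rightarrow> 'x) \<Rightarrow> bool" where
  "is_action act \<longleftrightarrow> (\<forall>x. act 0 x = x) \<and> (\<forall>g h x. act (g + h) x = act g (act h x))"

definition componentwise :: "('g \<Rightarrow> 'x \<Rightarrow> 'x) \<Rightarrow> 'g \<Rightarrow> ('n \<Rightarrow> 'x) \<Rightarrow> ('n \<Rightarrow> 'x)" where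
  "componentwise act g x = (\<lambda>i. act g (x i))"

definition free_action :: "('g::group_add \<Rightarrow> 'y \<Rightarrow> 'y) \<Rightarrow> bool" where
  "free_action act \<longleftrightarrow> (\<forall>g x. act g x = x \<longrightarrow> g = 0)"

definition continuous_action ::
    "('g::topological_space \<Rightarrow> 'y \<Rightarrow> 'y::topological_space) \<Rightarrow> bool" where
  "continuous_action act \<longleftrightarrow> continuous_on UNIV (\<lambda>(g, x). act g x)"

definition proper_action ::
    "('g::topological_space \<Rightarrow> 'y \<Rightarrow> 'y::topological_space) \<Rightarrow> bool" where
  "proper_action act \<longleftrightarrow> (\<forall>K. compact K \<longrightarrow> compact ((\<lambda>(g, x). (act g x, x)) -` K))"

definition amenable :: "'g::topological_group_add itself \<Rightarrow> bool" where
  "amenable TYPE('g) \<longleftrightarrow>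
     (\<exists>\<pi> :: nat \<Rightarrow> 'g measure.
        (\<forall>k. \<pi> k \<in> space (prob_algebra borel)) \<and>
        (\<forall>B \<in> sets borel. \<forall>g.
           (\<lambda>k. \<bar>measure (\<pi> k) B - measure (\<pi> k) ((\<lambda>b. b + g) ` B)\<bar>) \<longlonglongrightarrow> 0))"

definition invariant_model ::
    "('g::group_add \<Rightarrow> 'y \<Rightarrow> 'y) \<Rightarrow> ('g \<Rightarrow> 'y::topological_space measure) \<Rightarrow> bool" where
  "invariant_model act P \<longleftrightarrow>
     (\<forall>g h. \<forall>B \<in> sets borel. measure (P (h + g)) (act h ` B) = measure (P g) B)"

text \<open>
  The mixture of the measures \<open>P g\<close> under the distribution \<open>\<pi>\<close> of \<open>g\<close> is the Giry bind \<open>\<pi> \<bind> P\<close>.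
  Bind is meaningful only for a measurable kernel; for an invariant model measurability is
  automatic.
\<close>

lemma invariant_model_measurable:
  fixes act :: "'g::{topological_group_add, second_countable_topology} \<Rightarrow>
      'y \<Rightarrow> 'y::second_countable_topology"
  assumes act: "is_action act"
    and cont: "continuous_action act"
    and P: "\<And>g. P g \<in> space (prob_algebra borel)"
    and inv: "invariant_model act P"
  shows "P \<in> measurable borel (prob_algebra borel)"
    and "\<pi> \<in> space (prob_algebra borel) \<Longrightarrow> B \<in> sets borel \<Longrightarrow>
      emeasure (\<pi> \<bind> P) B = (\<integral>\<^sup>+ g. emeasure (P g) B \<partial>\<pi>)"
proof -
  have act_meas: "(\<lambda>(g, x). act g x) \<in> borel_measurable (borel \<Otimes>\<^sub>M borel)"
    using cont unfolding continuous_action_def borel_prod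
    by (intro borel_measurable_continuous_onI)
  have act1[measurable]: "act g \<in> borel_measurable borel" for g
    using measurable_Pair2[OF act_meas, of g] by simp
  have inverse: "act g (act (- g) x) = x" "act (- g) (act g x) = x" for g x
    using act unfolding is_action_def by (metis right_minus, metis left_minus)
  have image: "act g ` (act g -` B) = B" for g B
  proof (intro set_eqI iffI)
    fix x assume "x \<in> B"
    then have "act (- g) x \<in> act g -` B" by (simp add: inverse(1))
    then have "act g (act (- g) x) \<in> act g ` (act g -` B)" by (rule imageI)
    then show "x \<in> act g ` (act g -` B)" by (simp only: inverse(1))
  qed auto
  have eq: "P g = distr (P 0) borel (act g)" for g
  proof (rule measure_eqI)
    interpret Pg: prob_space "P g" using P[of g] by (simp add: space_prob_algebra)
    interpret P0: prob_space "P 0" using P[of 0] by (simp add: space_prob_algebra)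
    have sets: "sets (P g) = sets borel" "sets (P 0) = sets borel"
      using P by (auto simp: space_prob_algebra)
    have sp: "space (P 0) = UNIV" using sets_eq_imp_space_eq[OF sets(2)] by simp
    have m0: "act g \<in> measurable (P 0) borel"
      using act1[of g] by (simp add: measurable_cong_sets[OF sets(2) refl])
    show "sets (P g) = sets (distr (P 0) borel (act g))" by (simp add: sets)
    fix B assume "B \<in> sets (P g)"
    then have B: "B \<in> sets borel" by (simp add: sets)
    have pre: "act g -` B \<in> sets borel" using measurable_sets[OF act1 B, of g] by simp
    have "measure (P (g + 0)) (act g ` (act g -` B)) = measure (P 0) (act g -` B)"
      using inv[unfolded invariant_model_def, rule_format, OF pre] .
    then have "measure (P g) B = measure (P 0) (act g -` B)" unfolding image by simp
    then show "emeasure (P g) B = emeasure (distr (P 0) borel (act g)) B"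
      by (simp add: emeasure_distr[OF m0 B] sp Pg.emeasure_eq_measure P0.emeasure_eq_measure)
  qed
  show meas: "P \<in> measurable borel (prob_algebra borel)"
  proof (rule measurable_prob_algebraI)
    show "prob_space (P g)" if "g \<in> space borel" for g
      using P[of g] by (simp add: space_prob_algebra)
    have "P 0 \<in> space (subprob_algebra borel)"
      using P[of 0] by (auto simp: space_prob_algebra space_subprob_algebra prob_space_imp_subprob_space)
    then have "(\<lambda>g. distr (P 0) borel (act g)) \<in> measurable borel (subprob_algebra borel)"
      by (intro measurable_distr2[OF act_meas]) simp
    moreover have "P = (\<lambda>g. distr (P 0) borel (act g))" using eq by (rule ext)
    ultimately show "P \<in> measurable borel (subprob_algebra borel)" by metis
  qed
  assume pi: "\<pi> \<in> space (prob_algebra borel)" and B: "B \<in> sets borel"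
  then interpret pi: prob_space \<pi> by (simp add: space_prob_algebra)
  have "sets \<pi> = sets borel" using pi by (simp add: space_prob_algebra)
  then have "P \<in> measurable \<pi> (subprob_algebra borel)"
    using measurable_prob_algebraD[OF meas] by (simp cong: measurable_cong_sets)
  then show "emeasure (\<pi> \<bind> P) B = (\<integral>\<^sup>+ g. emeasure (P g) B \<partial>\<pi>)"
    by (rule emeasure_bind[OF pi.not_empty _ B])
qed

definition relatively_left_invariant ::
    "('g \<Rightarrow> 'y \<Rightarrow> 'y) \<Rightarrow> ('g \<Rightarrow> real) \<Rightarrow> 'y::topological_space measure \<Rightarrow> bool" where
  "relatively_left_invariant act chi \<mu> \<longleftrightarrow>
     (\<forall>g. 0 < chi g) \<and>
     (\<forall>g. \<forall>B \<in> sets borel. emeasure \<mu> (act g ` B) = ennreal (chi g) * emeasure \<mu> B)"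

definition has_density :: "'a measure \<Rightarrow> 'a measure \<Rightarrow> ('a \<Rightarrow> real) \<Rightarrow> bool" where
  "has_density M \<nu> f \<longleftrightarrow>
     f \<in> borel_measurable \<nu> \<and> (\<forall>x \<in> space \<nu>. 0 \<le> f x) \<and> M = density \<nu> (\<lambda>x. ennreal (f x))"

definition maximally_invariant :: "('g \<Rightarrow> 'y \<Rightarrow> 'y) \<Rightarrow> ('y \<Rightarrow> 'm) \<Rightarrow> bool" where
  "maximally_invariant act m \<longleftrightarrow> (\<forall>x x'. m x = m x' \<longleftrightarrow> (\<exists>g. x = act g x'))"

text \<open>
  The \<open>\<sigma>\<close>-algebra of the value space of \<open>m\<close> is fine enough to express every invariant event.
  Maximal invariance is a pointwise property and does not constrain that \<open>\<sigma>\<close>-algebra: it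
  could be trivial, in which case the distribution of \<open>m\<close> would carry no information. The
  condition holds for the quotient \<open>\<sigma>\<close>-algebra and, if the sample space is standard Borel, for
  every countably generated \<open>\<sigma>\<close>-algebra that separates points (by Blackwell's theorem).
\<close>

definition captures_invariant_events ::
    "('g \<Rightarrow> 'y \<Rightarrow> 'y) \<Rightarrow> ('y::topological_space \<Rightarrow> 'm) \<Rightarrow> 'm measure \<Rightarrow> bool" where
  "captures_invariant_events act m N \<longleftrightarrow>
     (\<forall>B \<in> sets borel. (\<forall>g. act g ` B = B) \<longrightarrow> (\<exists>A \<in> sets N. B = m -` A))"

text \<open>
  \<open>KL Q P\<close> is the extended-valued expectation under \<open>Q\<close> of \<open>ln (dQ/dP)\<close>. The library's
  \<open>KL_divergence b P Q\<close> (note the order of the arguments) is real-valued, hence \<open>0\<close> when the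
  integral diverges and meaningless when \<open>Q\<close> is not absolutely continuous with respect to \<open>P\<close>;
  in both cases the divergence is \<open>\<infinity>\<close>. The negative part of \<open>ln (dQ/dP)\<close> is always
  \<open>Q\<close>-integrable (lemma \<open>KL_negative_part_finite\<close>), so the integral can diverge only to \<open>+\<infinity>\<close>.
\<close>

definition KL :: "'a measure \<Rightarrow> 'a measure \<Rightarrow> ereal" where
  "KL Q P =
     (if absolutely_continuous P Q \<and> integrable Q (entropy_density (exp 1) P Q)
      then ereal (KL_divergence (exp 1) P Q) else \<infinity>)"

lemma KL_negative_part_finite:
  assumes P: "prob_space P" and Q: "prob_space Q"
    and ac: "absolutely_continuous P Q" "sets Q = sets P"
  shows "(\<integral>\<^sup>+ x. ennreal (- entropy_density (exp 1) P Q x) \<partial>Q) < \<infinity>"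
proof -
  interpret P: prob_space P by fact
  interpret Q: prob_space Q by fact
  have "finite_measure Q" by unfold_locales
  from P.real_RN_deriv[OF this ac] obtain D
    where D[measurable]: "D \<in> borel_measurable P"
      and RN: "AE x in P. RN_deriv P Q x = ennreal (D x)"
      and pos: "AE x in Q. 0 < D x" and nn: "\<And>x. 0 \<le> D x"
    by auto
  have Qd: "Q = density P (\<lambda>x. ennreal (D x))"
  proof -
    have "Q = density P (RN_deriv P Q)"
      using P.density_RN_deriv[OF ac] by simp
    also have "\<dots> = density P (\<lambda>x. ennreal (D x))"
      using RN by (intro density_cong) auto
    finally show ?thesis .
  qed
  have [measurable]: "entropy_density (exp 1) P Q \<in> borel_measurable P"
    by (rule measurable_entropy_density)
  have "(\<integral>\<^sup>+ x. ennreal (- entropy_density (exp 1) P Q x) \<partial>Q)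
      = (\<integral>\<^sup>+ x. ennreal (- entropy_density (exp 1) P Q x) \<partial>density P (\<lambda>x. ennreal (D x)))"
    by (rule arg_cong[where f = "\<lambda>M. nn_integral M _", OF Qd])
  also have "\<dots> = (\<integral>\<^sup>+ x. ennreal (D x) * ennreal (- entropy_density (exp 1) P Q x) \<partial>P)"
    by (rule nn_integral_density) measurable
  also have "\<dots> \<le> (\<integral>\<^sup>+ x. 1 \<partial>P)"
  proof (rule nn_integral_mono_AE, use RN in eventually_elim)
    fix x assume "RN_deriv P Q x = ennreal (D x)"
    then have e: "entropy_density (exp 1) P Q x = ln (D x)"
      using nn by (simp add: entropy_density_def log_def)
    have "D x * (- ln (D x)) \<le> 1"
    proof (cases "D x = 0")
      case False
      then have d: "0 < D x" using nn[of x] by simp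
      have "- ln (D x) = ln (1 / D x)" using d by (simp add: ln_div)
      also have "\<dots> \<le> 1 / D x - 1" using d by (intro ln_le_minus_one) auto
      finally have "D x * (- ln (D x)) \<le> D x * (1 / D x - 1)" using d by (intro mult_left_mono) auto
      also have "\<dots> \<le> 1" using d by (simp add: field_simps)
      finally show ?thesis .
    qed simp
    then show "ennreal (D x) * ennreal (- entropy_density (exp 1) P Q x) \<le> 1"
      unfolding e using nn by (subst ennreal_mult'[symmetric]) auto
  qed
  also have "\<dots> < \<infinity>" by (simp add: P.emeasure_space_1)
  finally show ?thesis .
qed

end

theory Submission
  imports Defs
begin

text \<open>
  For a prior \<open>\<pi>\<close> on the group, the mixture \<open>\<pi> \<bind> P\<close> is the law of \<open>g y\<close> with \<open>g\<close> drawn from \<open>\<pi>\<close> and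
  \<open>y\<close> from \<open>P 0\<close>, independently.

  Lower bound. The statistic \<open>m\<close> is invariant, so it has the same law under a mixture as under
  \<open>P 0\<close> or \<open>Q 0\<close>, and passing to the law of \<open>m\<close> does not increase the divergence. Data processing is
  used in a form with a truncation level, lemma \<open>ln_likelihood_ratio_pushforward\<close>; level \<open>0\<close> gives
  the lower bound.

  Upper bound. Let \<open>F\<close> be the density of the law of \<open>m\<close> under \<open>Q 0\<close> with respect to its law under
  \<open>P 0\<close>, composed with \<open>m\<close>, and let \<open>P'\<close> have density \<open>F\<close> with respect to \<open>P 0\<close>. Since \<open>F\<close> is
  invariant, mixing commutes with multiplication by \<open>F\<close>, and the divergence of the mixtures of \<open>Q\<close>
  and \<open>P\<close> is the divergence of the laws of \<open>m\<close> plus the divergence of the mixtures of \<open>Q 0\<close> and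
  \<open>P'\<close>. The measures \<open>Q 0\<close> and \<open>P'\<close> agree on invariant events, and for such a pair suitable priors
  make the divergence of the mixtures arbitrarily small (lemma \<open>small_divergence_mixture\<close>):

  \<^item> A proper free action has Borel coordinates \<open>y = h(y) s(y)\<close> along the orbits, with \<open>s\<close> invariant
    (lemma \<open>measurable_orbit_coordinates\<close>). Asymptotically right invariant priors \<open>\<pi>\<^sub>k\<close> forget
    \<open>h(y)\<close>, and \<open>s\<close> has the same law under \<open>Q 0\<close> and \<open>P'\<close>. Hence every bounded measurable function
    has asymptotically the same mean under both mixtures (lemma \<open>mixtures_merge\<close>).

  \<^item> Amenability is a setwise condition, so this convergence is only weak. If all mixtures stayed at
    a positive distance in total variation, then a single bounded function would separate all of
    them (lemma \<open>L1_separation\<close>), against the weak convergence; so some mixture brings the two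
    measures close in total variation (lemma \<open>close_mixture_exists\<close>).

  \<^item> Closeness in total variation bounds the divergence up to the contribution of large values of
    the likelihood ratio (lemma \<open>expected_ln_density_le\<close>). Truncated data processing, applied to the
    map \<open>(g, y) \<mapsto> g y\<close>, bounds that contribution for all priors at once by the one for \<open>Q 0\<close> and
    \<open>P'\<close>, which is small because the two log likelihood ratios of the theorem are integrable.
\<close>

section \<open>Separation of a convex set from the origin in \<open>L\<^sup>1\<close>\<close>

text \<open>
  The separating function is found as a limit of derivatives of a strictly convex, differentiable
  approximation of the \<open>L\<^sup>1\<close> norm, along a minimising sequence. The absolute value is smoothed to the
  length of the plane vector \<open>(d, s)\<close>; its derivative is \<open>smooth_sgn\<close>.
\<close>
definition smooth_abs :: "real \<Rightarrow> real \<Rightarrow> real" where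
  "smooth_abs d s = sqrt (d\<^sup>2 + s\<^sup>2)"

definition smooth_sgn :: "real \<Rightarrow> real \<Rightarrow> real" where
  "smooth_sgn d s = s / smooth_abs d s"

lemma measurable_smooth [measurable]:
  "smooth_abs d \<in> borel_measurable borel" "smooth_sgn d \<in> borel_measurable borel"
  unfolding smooth_abs_def[abs_def] smooth_sgn_def[abs_def] by measurable

lemma smooth_abs_bounds:
  assumes "0 < d"
  shows "\<bar>s\<bar> \<le> smooth_abs d s" "smooth_abs d s \<le> \<bar>s\<bar> + d" "0 < smooth_abs d s"
    "d \<le> smooth_abs d s"
proof -
  show "\<bar>s\<bar> \<le> smooth_abs d s" unfolding smooth_abs_def by (rule real_le_rsqrt) simp
  have "d\<^sup>2 + s\<^sup>2 \<le> (\<bar>s\<bar> + d)\<^sup>2" using assms by (simp add: power2_sum)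
  then show "smooth_abs d s \<le> \<bar>s\<bar> + d"
    unfolding smooth_abs_def using assms by (intro real_le_lsqrt) auto
  show "d \<le> smooth_abs d s" unfolding smooth_abs_def by (rule real_le_rsqrt) simp
  then show "0 < smooth_abs d s" using assms by linarith
qed

lemma smooth_sgn_bounds:
  assumes "0 < d"
  shows "\<bar>smooth_sgn d s\<bar> \<le> 1" "\<bar>s\<bar> - d \<le> smooth_sgn d s * s"
proof -
  note b = smooth_abs_bounds[OF assms, of s]
  show "\<bar>smooth_sgn d s\<bar> \<le> 1" unfolding smooth_sgn_def using b by (simp add: abs_div)
  have sq: "(smooth_abs d s)\<^sup>2 = d\<^sup>2 + s\<^sup>2" unfolding smooth_abs_def by simp
  have "(\<bar>s\<bar> - d) * smooth_abs d s \<le> s\<^sup>2"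
  proof (cases "\<bar>s\<bar> \<le> d")
    case True
    then have "(\<bar>s\<bar> - d) * smooth_abs d s \<le> 0" using b(3) by (simp add: mult_nonpos_nonneg)
    then show ?thesis using zero_le_power2[of s] by linarith
  next
    case False
    then have "(\<bar>s\<bar> - d) * smooth_abs d s \<le> (\<bar>s\<bar> - d) * (\<bar>s\<bar> + d)"
      using b(2) by (intro mult_left_mono) auto
    also have "\<dots> = s\<^sup>2 - d\<^sup>2" by (simp add: power2_eq_square algebra_simps flip: abs_mult)
    finally show ?thesis using zero_le_power2[of d] by linarith
  qed
  then show "\<bar>s\<bar> - d \<le> smooth_sgn d s * s"
    unfolding smooth_sgn_def using b(3) by (simp add: pos_le_divide_eq power2_eq_square)
qed

text \<open>
  The convexity gap in terms of the derivative: with the vectors \<open>(d, x)\<close> and \<open>(d, z)\<close> of the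
  plane, the gap of the tangent at \<open>z\<close> is \<open>\<bar>(d, x)\<bar> / 2\<close> times the squared distance of their
  directions, \<open>smooth_sgn\<close> is the second coordinate of the direction, and \<open>\<bar>(d, x)\<bar> \<ge> d\<close>.
\<close>

lemma smooth_abs_tangent:
  assumes "0 < d"
  shows "smooth_abs d z + smooth_sgn d z * (x - z) + d / 2 * (smooth_sgn d x - smooth_sgn d z)\<^sup>2
    \<le> smooth_abs d x"
proof -
  define X Z where "X = smooth_abs d x" and "Z = smooth_abs d z"
  have pos: "0 < X" "0 < Z" "d \<le> X" using smooth_abs_bounds[OF assms] unfolding X_def Z_def by auto
  have sq: "X\<^sup>2 = d\<^sup>2 + x\<^sup>2" "Z\<^sup>2 = d\<^sup>2 + z\<^sup>2" unfolding X_def Z_def smooth_abs_def by auto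
  have one: "(d/X)\<^sup>2 + (x/X)\<^sup>2 = 1" "(d/Z)\<^sup>2 + (z/Z)\<^sup>2 = 1"
    using pos sq by (simp_all add: power_divide flip: add_divide_distrib sq)
  have Z: "Z = (d * d + z * z) / Z" using pos sq by (simp add: field_simps power2_eq_square)
  have "X - Z - z/Z * (x - z) = X * (1 - (d/X) * (d/Z) - (x/X) * (z/Z))"
    using pos by (subst Z) (simp add: field_simps)
  also have "\<dots> = X / 2 * ((d/X - d/Z)\<^sup>2 + (x/X - z/Z)\<^sup>2)"
    using one by (simp add: power2_diff algebra_simps)
  finally have e: "X - Z - z/Z * (x - z) = X / 2 * ((d/X - d/Z)\<^sup>2 + (x/X - z/Z)\<^sup>2)" .
  have "d / 2 * (x/X - z/Z)\<^sup>2 \<le> X / 2 * (x/X - z/Z)\<^sup>2"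
    using pos by (intro mult_right_mono) auto
  also have "\<dots> \<le> X / 2 * ((d/X - d/Z)\<^sup>2 + (x/X - z/Z)\<^sup>2)"
    using pos by (intro mult_left_mono) auto
  finally show ?thesis using e unfolding smooth_sgn_def X_def Z_def by simp
qed

lemma AE_summable_of_geometric_integrals:
  fixes f :: "nat \<Rightarrow> 'a \<Rightarrow> real"
  assumes int: "\<And>j. integrable M (f j)" and nn: "\<And>j x. 0 \<le> f j x"
    and le: "\<And>j. (\<integral>x. f j x \<partial>M) \<le> C * (1/2) ^ j"
  shows "AE x in M. summable (\<lambda>j. f j x)"
proof -
  have [measurable]: "f j \<in> borel_measurable M" for j using int[of j] by simp
  have C: "0 \<le> C" 
  proof -
    have "0 \<le> (\<integral>x. f 0 x \<partial>M)" using nn by (intro integral_nonneg_AE) auto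
    then show ?thesis using le[of 0] by simp
  qed
  have "(\<integral>\<^sup>+x. (\<Sum>j. ennreal (f j x)) \<partial>M) = (\<Sum>j. \<integral>\<^sup>+x. ennreal (f j x) \<partial>M)"
    by (rule nn_integral_suminf) auto
  also have "\<dots> = (\<Sum>j. ennreal (\<integral>x. f j x \<partial>M))"
    using int nn by (intro suminf_cong nn_integral_eq_integral) auto
  also have "\<dots> \<le> (\<Sum>j. ennreal (C * (1/2) ^ j))"
    using le by (intro suminf_le) (auto intro: ennreal_leI)
  also have "\<dots> = ennreal (\<Sum>j. C * (1/2) ^ j)"
    using C by (intro suminf_ennreal2 summable_mult summable_geometric) auto
  also have "\<dots> < \<infinity>" by simp
  finally have "AE x in M. (\<Sum>j. ennreal (f j x)) \<noteq> \<infinity>"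
    by (intro nn_integral_PInf_AE) (auto simp: top.not_eq_extremum)
  then show ?thesis
    by eventually_elim (rule summable_suminf_not_top, auto simp: nn)
qed

text \<open>
  Hahn-Banach separation of a convex set from the origin of \<open>L\<^sup>1\<close>, with the functional given by a
  bounded function. Take near minimisers \<open>w j\<close> of the smoothed norm. The set need not be complete and
  the \<open>w j\<close> need not converge, but strict convexity makes the bounded functions
  \<open>smooth_sgn d (w j)\<close> converge: the midpoint of two near minimisers cannot do better than the
  infimum. Their limit \<open>\<phi>\<close> serves as the derivative at the missing minimiser. Its integral against
  \<open>w j\<close> is nearly the norm of \<open>w j\<close>, and its integral against any \<open>v \<in> W\<close> is not smaller, because
  moving from a minimiser towards \<open>v\<close> does not decrease the norm. The factor \<open>1/2\<close> pays for the
  smoothing.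
\<close>
lemma L1_separation:
  fixes W :: "('a \<Rightarrow> real) set"
  assumes M: "prob_space M"
    and ne: "W \<noteq> {}"
    and int: "\<And>w. w \<in> W \<Longrightarrow> integrable M w"
    and conv: "\<And>u v t. u \<in> W \<Longrightarrow> v \<in> W \<Longrightarrow> 0 \<le> t \<Longrightarrow> t \<le> 1 \<Longrightarrow>
      (\<lambda>x. (1 - t) * u x + t * v x) \<in> W"
    and c: "0 < c" and far: "\<And>w. w \<in> W \<Longrightarrow> c \<le> (\<integral>x. \<bar>w x\<bar> \<partial>M)"
  obtains \<phi> where "\<phi> \<in> borel_measurable M" "\<And>x. \<bar>\<phi> x\<bar> \<le> 1"
    "\<And>w. w \<in> W \<Longrightarrow> c / 2 \<le> (\<integral>x. \<phi> x * w x \<partial>M)"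
proof -
  interpret prob_space M by fact
  define d where "d = c / 2"
  have d: "0 < d" using c by (simp add: d_def)
  define J where "J = (\<lambda>w. \<integral>x. smooth_abs d (w x) \<partial>M)"
  note ab = smooth_abs_bounds[OF d] and sb = smooth_sgn_bounds[OF d]
  have meas: "w \<in> borel_measurable M" if "w \<in> W" for w using int[OF that] by simp
  have intH: "integrable M (\<lambda>x. smooth_abs d (w x))" if "w \<in> W" for w
  proof (rule Bochner_Integration.integrable_bound)
    show "integrable M (\<lambda>x. \<bar>w x\<bar> + d)" using int[OF that] by auto
    show "(\<lambda>x. smooth_abs d (w x)) \<in> borel_measurable M" using meas[OF that] by simp
    show "AE x in M. norm (smooth_abs d (w x)) \<le> norm (\<bar>w x\<bar> + d)"
      using ab(2,3) d by (intro AE_I2) (simp add: less_imp_le)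
  qed
  have int_bdd: "integrable M (\<lambda>x. f x * w x)"
    if "w \<in> W" "f \<in> borel_measurable M" "\<And>x. \<bar>f x\<bar> \<le> 1" for f w
  proof (rule Bochner_Integration.integrable_bound[OF int[OF that(1)]])
    show "(\<lambda>x. f x * w x) \<in> borel_measurable M" using meas[OF that(1)] that(2) by simp
    show "AE x in M. norm (f x * w x) \<le> norm (w x)"
      using that(3) by (intro AE_I2) (simp add: abs_mult mult_left_le_one_le)
  qed
  have int_sq: "integrable M (\<lambda>x. (smooth_sgn d (u x) - smooth_sgn d (v x))\<^sup>2)"
    if "u \<in> W" "v \<in> W" for u v
  proof (rule integrable_const_bound[where B = 4])
    have "(smooth_sgn d a - smooth_sgn d b)\<^sup>2 \<le> 2\<^sup>2" for a b
      using sb(1)[of a] sb(1)[of b] by (intro power2_le_iff_abs_le[THEN iffD2]) auto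
    then show "AE x in M. norm ((smooth_sgn d (u x) - smooth_sgn d (v x))\<^sup>2) \<le> 4" by simp
  qed (use meas that in simp)
  define I where "I = Inf (J ` W)"
  have J0: "0 \<le> J w" if "w \<in> W" for w
    unfolding J_def using ab(3) by (intro integral_nonneg_AE) (simp add: less_imp_le)
  have bdd: "bdd_below (J ` W)" using J0 by (intro bdd_belowI2)
  have I_le: "I \<le> J w" if "w \<in> W" for w unfolding I_def using bdd that by (rule cINF_lower)
  \<comment> \<open>The signs of two near minimisers are close, because their midpoint is no better than \<open>I\<close>.\<close>
  have close: "(\<integral>x. (smooth_sgn d (u x) - smooth_sgn d (v x))\<^sup>2 \<partial>M) \<le> 8 * e / d"
    if u: "u \<in> W" "J u \<le> I + e" and v: "v \<in> W" "J v \<le> I + e" for u v e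
  proof -
    define z where "z = (\<lambda>x. (1 - 1/2) * u x + 1/2 * v x)"
    have z: "z \<in> W" unfolding z_def using u v by (intro conv) auto
    have "2 * smooth_abs d (z x) + d / 4 * (smooth_sgn d (u x) - smooth_sgn d (v x))\<^sup>2
        \<le> smooth_abs d (u x) + smooth_abs d (v x)" for x
    proof -
      define p q r where "p = smooth_sgn d (u x)" and "q = smooth_sgn d (v x)"
        and "r = smooth_sgn d (z x)"
      have "smooth_sgn d (z x) * (u x - z x) + smooth_sgn d (z x) * (v x - z x) = 0"
        unfolding z_def by (simp add: field_simps)
      moreover have "d / 4 * (p - q)\<^sup>2 \<le> d / 2 * (p - r)\<^sup>2 + d / 2 * (q - r)\<^sup>2"
      proof -
        have "0 \<le> d / 4 * (p + q - 2 * r)\<^sup>2" using d by simp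
        also have "\<dots> = d / 2 * (p - r)\<^sup>2 + d / 2 * (q - r)\<^sup>2 - d / 4 * (p - q)\<^sup>2"
          by (simp add: power2_eq_square field_simps)
        finally show ?thesis by simp
      qed
      ultimately show ?thesis
        using smooth_abs_tangent[OF d, of "z x" "u x"] smooth_abs_tangent[OF d, of "z x" "v x"]
        unfolding p_def q_def r_def by linarith
    qed
    then have "(\<integral>x. 2 * smooth_abs d (z x) + d / 4 * (smooth_sgn d (u x) - smooth_sgn d (v x))\<^sup>2 \<partial>M)
        \<le> (\<integral>x. smooth_abs d (u x) + smooth_abs d (v x) \<partial>M)"
      using intH[OF z] intH[OF u(1)] intH[OF v(1)] int_sq[OF u(1) v(1)]
      by (intro integral_mono) auto
    then have "2 * J z + d / 4 * (\<integral>x. (smooth_sgn d (u x) - smooth_sgn d (v x))\<^sup>2 \<partial>M) \<le> J u + J v"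
      using intH[OF z] intH[OF u(1)] intH[OF v(1)] int_sq[OF u(1) v(1)] by (simp add: J_def)
    then have "d / 4 * (\<integral>x. (smooth_sgn d (u x) - smooth_sgn d (v x))\<^sup>2 \<partial>M) \<le> 2 * e"
      using I_le[OF z] u(2) v(2) by linarith
    then show ?thesis using d by (simp add: field_simps)
  qed
  have "\<exists>w\<in>W. J w < I + (1/4)^j" for j :: nat
  proof -
    have "Inf (J ` W) < I + (1/4)^j" unfolding I_def by simp
    then show ?thesis using cINF_less_iff[OF ne bdd] by blast
  qed
  then obtain w where w: "\<And>j. w j \<in> W" "\<And>j. J (w j) < I + (1/4)^j" by metis
  define s where "s j x = smooth_sgn d (w j x)" for j x
  have s_meas[measurable]: "s j \<in> borel_measurable M" for j
    unfolding s_def[abs_def] using meas[OF w(1)] by measurable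
  have s1: "\<bar>s j x\<bar> \<le> 1" for j x unfolding s_def by (rule sb)
  have "AE x in M. summable (\<lambda>j. \<bar>s (Suc j) x - s j x\<bar>)"
  proof (rule AE_summable_of_geometric_integrals[where C = "8 / d + 1"])
    fix j :: nat
    have sq: "(\<integral>x. (s (Suc j) x - s j x)\<^sup>2 \<partial>M) \<le> 8 * (1/4)^j / d"
      unfolding s_def using w(2)[of j] w(2)[of "Suc j"] zero_le_power[of "1/4 :: real" j]
      by (intro close w(1)) (auto simp del: zero_le_power)
    \<comment> \<open>This turns the square integrals, of order \<open>4\<^sup>-\<^sup>j\<close>, into integrals of order \<open>2\<^sup>-\<^sup>j\<close>.\<close>
    have bd: "\<bar>a\<bar> \<le> 2^j * a\<^sup>2 + (1/2)^j" for a :: real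
    proof (cases "\<bar>a\<bar> \<le> (1/2)^j")
      case False
      then have "(1/2)^j * \<bar>a\<bar> \<le> \<bar>a\<bar> * \<bar>a\<bar>" by (intro mult_right_mono) auto
      then have "\<bar>a\<bar> \<le> 2^j * a\<^sup>2"
        by (simp add: power_one_over field_simps power2_eq_square flip: abs_mult)
      then show ?thesis by (intro add_increasing2) auto
    qed (simp add: add_increasing)
    show int1: "integrable M (\<lambda>x. \<bar>s (Suc j) x - s j x\<bar>)"
      using s1 by (intro integrable_const_bound[where B = 2] AE_I2)
        (auto intro: order_trans[OF abs_triangle_ineq4] simp: s1 add_mono[OF s1 s1, simplified])
    have int2: "integrable M (\<lambda>x. (s (Suc j) x - s j x)\<^sup>2)" unfolding s_def by (intro int_sq w(1))
    have "(\<integral>x. \<bar>s (Suc j) x - s j x\<bar> \<partial>M) \<le> (\<integral>x. 2^j * (s (Suc j) x - s j x)\<^sup>2 + (1/2)^j \<partial>M)"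
      using int1 int2 bd by (intro integral_mono) auto
    also have "\<dots> = 2^j * (\<integral>x. (s (Suc j) x - s j x)\<^sup>2 \<partial>M) + (1/2)^j"
      using int2 by (simp add: prob_space)
    also have "\<dots> \<le> 2^j * (8 * (1/4)^j / d) + (1/2)^j" using sq by (intro add_mono mult_left_mono) auto
    also have "2^j * (8 * (1/4)^j / d) = 8 / d * ((2 * (1/4)) ^ j :: real)"
      by (subst power_mult_distrib) simp
    finally show "(\<integral>x. \<bar>s (Suc j) x - s j x\<bar> \<partial>M) \<le> (8 / d + 1) * (1/2)^j"
      by (simp add: algebra_simps)
  qed auto
  then have conv_s: "AE x in M. convergent (\<lambda>j. s j x)"
  proof eventually_elim
    case (elim x)
    then have "summable (\<lambda>j. s (Suc j) x - s j x)" by (rule summable_rabs_cancel)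
    then obtain L where "(\<lambda>n. \<Sum>j<n. s (Suc j) x - s j x) \<longlonglongrightarrow> L"
      unfolding summable_def sums_def by blast
    then have "(\<lambda>n. (s n x - s 0 x) + s 0 x) \<longlonglongrightarrow> L + s 0 x"
      by (intro tendsto_add tendsto_const) (simp add: sum_lessThan_telescope[of "\<lambda>j. s j x"])
    then show ?case by (auto simp: convergent_def)
  qed
  define \<phi> where "\<phi> = (\<lambda>x. if convergent (\<lambda>j. s j x) then lim (\<lambda>j. s j x) else 0)"
  have \<phi>_meas[measurable]: "\<phi> \<in> borel_measurable M" unfolding \<phi>_def Cauchy_convergent_iff[symmetric] by measurable
  have \<phi>1: "\<bar>\<phi> x\<bar> \<le> 1" for x
  proof (cases "convergent (\<lambda>j. s j x)")
    case True
    then have "(\<lambda>j. \<bar>s j x\<bar>) \<longlonglongrightarrow> \<bar>\<phi> x\<bar>"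
      unfolding \<phi>_def by (auto intro: tendsto_rabs simp: convergent_LIMSEQ_iff)
    then show ?thesis by (rule LIMSEQ_le_const2) (use s1 in auto)
  qed (simp add: \<phi>_def)
  have "c / 2 \<le> (\<integral>x. \<phi> x * v x \<partial>M)" if v: "v \<in> W" for v
  proof -
    \<comment> \<open>The step towards \<open>v\<close> tends to \<open>0\<close>, so that \<open>z j\<close> is still minimising, but as the square root
      of the defect of \<open>w j\<close>, so that the defect divided by the step still vanishes.\<close>
    define t :: "nat \<Rightarrow> real" where "t j = (1/2)^j" for j
    have t: "0 < t j" "t j \<le> 1" "t j * t j = (1/4)^j" for j
      unfolding t_def by (auto simp: power_le_one power_mult_distrib[symmetric])
    define z where "z j = (\<lambda>x. (1 - t j) * w j x + t j * v x)" for j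
    have z: "z j \<in> W" for j unfolding z_def using t[of j] w(1) v by (intro conv) auto
    define r where "r j x = smooth_sgn d (z j x)" for j x
    have [measurable]: "r j \<in> borel_measurable M" for j
      unfolding r_def[abs_def] using meas[OF z] by measurable
    have r1: "\<bar>r j x\<bar> \<le> 1" for j x unfolding r_def by (rule sb)
    have tangent: "smooth_abs d (z j x) + t j * (r j x * w j x - r j x * v x) \<le> smooth_abs d (w j x)"
      for j x
    proof -
      have "w j x - z j x = t j * (w j x - v x)" unfolding z_def by (simp add: algebra_simps)
      then have "r j x * (w j x - z j x) = r j x * (t j * (w j x - v x))" by (rule arg_cong)
      then have "r j x * (w j x - z j x) = t j * (r j x * w j x - r j x * v x)"
        by (simp only: right_diff_distrib mult.left_commute)
      moreover have "0 \<le> d / 2 * (smooth_sgn d (w j x) - smooth_sgn d (z j x))\<^sup>2" using d by simp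
      ultimately show ?thesis
        using smooth_abs_tangent[OF d, of "z j x" "w j x"] unfolding r_def by linarith
    qed
    have rw: "integrable M (\<lambda>x. r j x * w j x)" "integrable M (\<lambda>x. r j x * v x)"
      "integrable M (\<lambda>x. r j x * z j x)" for j
      using r1 w(1) v z by (intro int_bdd; simp)+
    have lower: "c - d - t j \<le> (\<integral>x. r j x * v x \<partial>M)" for j
    proof -
      have "(\<integral>x. smooth_abs d (z j x) + t j * (r j x * w j x - r j x * v x) \<partial>M)
          \<le> (\<integral>x. smooth_abs d (w j x) \<partial>M)"
        using tangent rw intH[OF z] intH[OF w(1)] by (intro integral_mono) auto
      then have "J (z j) + t j * ((\<integral>x. r j x * w j x \<partial>M) - (\<integral>x. r j x * v x \<partial>M)) \<le> J (w j)"
        using rw intH[OF z] by (simp add: J_def)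
      then have "t j * ((\<integral>x. r j x * w j x \<partial>M) - (\<integral>x. r j x * v x \<partial>M)) \<le> t j * t j"
        using I_le[OF z, of j] w(2)[of j] t(3)[of j] by linarith
      then have 1: "(\<integral>x. r j x * w j x \<partial>M) - (\<integral>x. r j x * v x \<partial>M) \<le> t j"
        using t(1)[of j] by simp
      have "c - d \<le> (\<integral>x. \<bar>z j x\<bar> - d \<partial>M)"
        using far[OF z, of j] int[OF z, of j] by (simp add: prob_space)
      also have "\<dots> \<le> (\<integral>x. r j x * z j x \<partial>M)"
        using rw(3) int[OF z, of j] sb(2) unfolding r_def by (intro integral_mono) auto
      also have "\<dots> = (\<integral>x. (1 - t j) * (r j x * w j x) + t j * (r j x * v x) \<partial>M)"
        unfolding z_def by (simp add: algebra_simps)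
      also have "\<dots> = (1 - t j) * (\<integral>x. r j x * w j x \<partial>M) + t j * (\<integral>x. r j x * v x \<partial>M)"
        using rw by simp
      also have "\<dots> = (\<integral>x. r j x * v x \<partial>M)
          + (1 - t j) * ((\<integral>x. r j x * w j x \<partial>M) - (\<integral>x. r j x * v x \<partial>M))"
        by (simp add: algebra_simps)
      also have "\<dots> \<le> (\<integral>x. r j x * v x \<partial>M) + (1 - t j) * t j"
        using 1 t(2)[of j] by (intro add_left_mono mult_left_mono) auto
      also have "\<dots> \<le> (\<integral>x. r j x * v x \<partial>M) + t j"
        using t(1,2)[of j] by (simp add: mult_left_le_one_le)
      finally show ?thesis by simp
    qed
    have Jz: "J (z j) \<le> I + t j * (1 + J v)" for j
    proof -
      have "smooth_abs d (z j x) \<le> (1 - t j) * smooth_abs d (w j x) + t j * smooth_abs d (v x)" for x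
      proof -
        define A B where "A = smooth_abs d (z j x) + r j x * (w j x - z j x)"
          and "B = smooth_abs d (z j x) + r j x * (v x - z j x)"
        have "0 \<le> d / 2 * (smooth_sgn d y - smooth_sgn d (z j x))\<^sup>2" for y using d by simp
        then have A: "A \<le> smooth_abs d (w j x)" and B: "B \<le> smooth_abs d (v x)"
          using smooth_abs_tangent[OF d, of "z j x" "w j x"]
            smooth_abs_tangent[OF d, of "z j x" "v x"] unfolding A_def B_def r_def
          by (smt (verit))+
        have "smooth_abs d (z j x) = (1 - t j) * A + t j * B"
        proof -
          have "(1 - t j) * (w j x - z j x) + t j * (v x - z j x) = 0"
            unfolding z_def by (simp add: algebra_simps)
          then have "r j x * ((1 - t j) * (w j x - z j x) + t j * (v x - z j x)) = 0" by simp
          moreover have "(1 - t j) * A + t j * B = smooth_abs d (z j x)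
              + r j x * ((1 - t j) * (w j x - z j x) + t j * (v x - z j x))"
            unfolding A_def B_def by (simp add: algebra_simps)
          ultimately show ?thesis by simp
        qed
        also have "\<dots> \<le> (1 - t j) * smooth_abs d (w j x) + t j * smooth_abs d (v x)"
          using A B t[of j] by (intro add_mono mult_left_mono) auto
        finally show ?thesis .
      qed
      then have "J (z j) \<le> (\<integral>x. (1 - t j) * smooth_abs d (w j x) + t j * smooth_abs d (v x) \<partial>M)"
        unfolding J_def using intH[OF z] intH[OF w(1)] intH[OF v] by (intro integral_mono) auto
      also have "\<dots> = (1 - t j) * J (w j) + t j * J v"
        unfolding J_def using intH[OF w(1)] intH[OF v] by simp
      also have "\<dots> \<le> J (w j) + t j * J v" using t[of j] J0[OF w(1), of j] by (simp add: algebra_simps)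
      also have "\<dots> \<le> I + t j * t j + t j * J v" using w(2)[of j] t(3)[of j] by linarith
      also have "\<dots> \<le> I + t j + t j * J v" using t(1,2)[of j] by (simp add: mult_left_le_one_le)
      finally show ?thesis by (simp add: algebra_simps)
    qed
    have "AE x in M. summable (\<lambda>j. (r j x - s j x)\<^sup>2)"
    proof (rule AE_summable_of_geometric_integrals[where C = "8 * (1 + J v) / d"])
      fix j :: nat
      show "integrable M (\<lambda>x. (r j x - s j x)\<^sup>2)" unfolding r_def s_def by (intro int_sq z w(1))
      have "t j * t j \<le> t j * (1 + J v)" using t[of j] J0[OF v] by (intro mult_left_mono) auto
      then have "(\<integral>x. (r j x - s j x)\<^sup>2 \<partial>M) \<le> 8 * (t j * (1 + J v)) / d"
        unfolding r_def s_def using Jz[of j] w(2)[of j] t(3)[of j] by (intro close z w(1)) auto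
      then show "(\<integral>x. (r j x - s j x)\<^sup>2 \<partial>M) \<le> 8 * (1 + J v) / d * (1/2)^j"
        by (simp add: t_def algebra_simps)
    qed auto
    with conv_s have r_lim: "AE x in M. (\<lambda>j. r j x * v x) \<longlonglongrightarrow> \<phi> x * v x"
    proof eventually_elim
      case (elim x)
      have "(\<lambda>j. (r j x - s j x)\<^sup>2) \<longlonglongrightarrow> 0" using elim(2) by (rule summable_LIMSEQ_zero)
      then have "(\<lambda>j. sqrt ((r j x - s j x)\<^sup>2)) \<longlonglongrightarrow> sqrt 0" by (rule tendsto_real_sqrt)
      then have "(\<lambda>j. r j x - s j x) \<longlonglongrightarrow> 0" by (simp add: tendsto_rabs_zero_iff)
      moreover have "(\<lambda>j. s j x) \<longlonglongrightarrow> \<phi> x"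
        using elim(1) by (simp add: \<phi>_def convergent_LIMSEQ_iff)
      ultimately have "(\<lambda>j. (r j x - s j x) + s j x) \<longlonglongrightarrow> 0 + \<phi> x" by (rule tendsto_add)
      then show ?case by (intro tendsto_mult) auto
    qed
    have "(\<lambda>j. \<integral>x. r j x * v x \<partial>M) \<longlonglongrightarrow> (\<integral>x. \<phi> x * v x \<partial>M)"
    proof (rule integral_dominated_convergence[where w = "\<lambda>x. \<bar>v x\<bar>"])
      show "AE x in M. norm (r j x * v x) \<le> \<bar>v x\<bar>" for j
        using r1 by (intro AE_I2) (simp add: abs_mult mult_left_le_one_le)
    qed (use meas[OF v] int[OF v] r_lim in auto)
    moreover have "(\<lambda>j. c - d - t j) \<longlonglongrightarrow> c - d - 0"
      unfolding t_def by (intro tendsto_intros LIMSEQ_realpow_zero) auto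
    ultimately have "c - d - 0 \<le> (\<integral>x. \<phi> x * v x \<partial>M)"
      using lower by (intro LIMSEQ_le) auto
    then show ?thesis by (simp add: d_def)
  qed
  then show ?thesis using that[OF \<phi>_meas \<phi>1] by blast
qed

section \<open>Likelihood ratios and their images\<close>

lemma real_density_exists:
  assumes M: "prob_space M" and N: "prob_space N"
    and ac: "absolutely_continuous M N" "sets N = sets M"
  obtains f :: "'a \<Rightarrow> real" where "f \<in> borel_measurable M" "\<And>x. 0 \<le> f x"
    "N = density M (\<lambda>x. ennreal (f x))"
proof -
  interpret M: prob_space M by fact
  interpret N: prob_space N by fact
  have "finite_measure N" by unfold_locales
  from M.real_RN_deriv[OF this ac] obtain f where f: "f \<in> borel_measurable M"
    "AE x in M. RN_deriv M N x = ennreal (f x)" "\<And>x. 0 \<le> f x" by metis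
  have "N = density M (RN_deriv M N)" using M.density_RN_deriv[OF ac] by simp
  also have "\<dots> = density M (\<lambda>x. ennreal (f x))" using f by (intro density_cong) auto
  finally show ?thesis using that f by blast
qed

lemma integrable_prob_density:
  fixes f :: "'a \<Rightarrow> real"
  assumes f[measurable]: "f \<in> borel_measurable M" "\<And>x. 0 \<le> f x"
    and N: "prob_space (density M (\<lambda>x. ennreal (f x)))"
  shows "integrable M f"
proof (rule integrableI_nonneg)
  have "(\<integral>\<^sup>+x. ennreal (f x) \<partial>M) = emeasure (density M (\<lambda>x. ennreal (f x))) (space M)"
    by (subst emeasure_density) (auto intro!: nn_integral_cong)
  also have "\<dots> = 1" using prob_space.emeasure_space_1[OF N] by simp
  finally show "(\<integral>\<^sup>+x. ennreal (f x) \<partial>M) < \<infinity>" by simp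
qed (use f in auto)

lemma measure_eq_integral_density:
  fixes f :: "'a \<Rightarrow> real"
  assumes [measurable]: "f \<in> borel_measurable M" and nn: "\<And>x. 0 \<le> f x" and A[measurable]: "A \<in> sets M"
  shows "measure (density M (\<lambda>x. ennreal (f x))) A = (\<integral>x. indicator A x * f x \<partial>M)"
proof -
  have "measure (density M f) A = (\<integral>x. indicator A x \<partial>density M f)"
    using sets.sets_into_space[OF A] by (simp add: Int_absorb2)
  also have "\<dots> = (\<integral>x. f x * indicator A x \<partial>M)"
    using nn by (subst integral_real_density) auto
  finally show ?thesis by (simp add: mult.commute)
qed

text \<open>
  The likelihood ratio \<open>r\<close> of the images under \<open>T\<close> is the conditional mean of \<open>D\<close> given \<open>T\<close>. After
  multiplication by \<open>D\<close> the quotient is at most \<open>r(T x)\<close> where \<open>r(T x) \<ge> K\<close> and at most \<open>D x\<close>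
  elsewhere; the two regions are inverse images under \<open>T\<close>, so the bounds integrate to the
  probabilities of complementary events.
\<close>
lemma likelihood_ratio_pushforward:
  fixes D :: "'a \<Rightarrow> real" and r :: "'b \<Rightarrow> real"
  assumes D[measurable]: "D \<in> borel_measurable P" and Q: "prob_space (density P D)"
    and T[measurable]: "T \<in> measurable P N" and r[measurable]: "r \<in> borel_measurable N"
    and nn: "\<And>x. 0 \<le> D x" "\<And>y. 0 \<le> r y"
    and eq: "distr (density P D) N T = density (distr P N T) r"
    and K: "0 \<le> K"
  shows "(\<integral>\<^sup>+x. ennreal (max (r (T x)) K / max (D x) K) \<partial>density P D) \<le> 1"
proof -
  let ?Q = "density P D"
  let ?U = "{y \<in> space N. K \<le> r y}"
  let ?V = "T -` (space N - ?U) \<inter> space P"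
  have le: "D x * (max (r (T x)) K / max (D x) K) \<le> (if K \<le> r (T x) then r (T x) else D x)" for x
  proof (cases "D x = 0")
    case False
    then have pos: "0 < D x" "0 < max (D x) K" using nn(1)[of x] by auto
    have "D x / max (D x) K \<le> 1" "K * (D x / max (D x) K) \<le> D x"
      using pos K nn(1)[of x] by (auto simp: field_simps max_def)
    then show ?thesis
      using mult_right_mono[of "D x / max (D x) K" 1 "r (T x)"] nn(2)[of "T x"]
      by (auto simp: max_def field_simps)
  qed (use nn in auto)
  have "(\<integral>\<^sup>+x. ennreal (max (r (T x)) K / max (D x) K) \<partial>?Q)
      = (\<integral>\<^sup>+x. ennreal (D x) * ennreal (max (r (T x)) K / max (D x) K) \<partial>P)"
    by (rule nn_integral_density) measurable
  also have "\<dots> \<le> (\<integral>\<^sup>+x. ennreal (r (T x)) * indicator ?U (T x) + ennreal (D x) * indicator ?V x \<partial>P)"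
  proof (rule nn_integral_mono)
    fix x assume x: "x \<in> space P"
    have "T x \<in> space N" using x T by (rule measurable_space[rotated])
    moreover have "ennreal (D x) * ennreal (max (r (T x)) K / max (D x) K)
        = ennreal (D x * (max (r (T x)) K / max (D x) K))"
      using nn by (intro ennreal_mult'[symmetric])
    ultimately show "ennreal (D x) * ennreal (max (r (T x)) K / max (D x) K)
        \<le> ennreal (r (T x)) * indicator ?U (T x) + ennreal (D x) * indicator ?V x"
      using le[of x] x by (auto simp: indicator_def intro: ennreal_leI split: if_splits)
  qed
  also have "(\<integral>\<^sup>+x. ennreal (r (T x)) * indicator ?U (T x)
        + ennreal (D x) * indicator (T -` (space N - ?U) \<inter> space P) x \<partial>P)
      = (\<integral>\<^sup>+x. ennreal (r (T x)) * indicator ?U (T x) \<partial>P)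
        + (\<integral>\<^sup>+x. ennreal (D x) * indicator (T -` (space N - ?U) \<inter> space P) x \<partial>P)"
    by (intro nn_integral_add) measurable
  also have "(\<integral>\<^sup>+x. ennreal (r (T x)) * indicator ?U (T x) \<partial>P)
      = (\<integral>\<^sup>+y. ennreal (r y) * indicator ?U y \<partial>distr P N T)"
    by (subst nn_integral_distr) auto
  also have "\<dots> = emeasure (density (distr P N T) r) ?U"
    by (subst emeasure_density) auto
  also have "\<dots> = emeasure ?Q (T -` ?U \<inter> space P)"
    unfolding eq[symmetric] by (subst emeasure_distr) auto
  also have "(\<integral>\<^sup>+x. ennreal (D x) * indicator (T -` (space N - ?U) \<inter> space P) x \<partial>P)
      = emeasure ?Q (T -` (space N - ?U) \<inter> space P)"
    by (subst emeasure_density) auto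
  also have "emeasure ?Q (T -` ?U \<inter> space P) + emeasure ?Q (T -` (space N - ?U) \<inter> space P)
      = emeasure ?Q ((T -` ?U \<inter> space P) \<union> (T -` (space N - ?U) \<inter> space P))"
    by (intro plus_emeasure) auto
  also have "\<dots> \<le> 1" by (rule subprob_space.subprob_emeasure_le_1[OF prob_space_imp_subprob_space[OF Q]])
  finally show ?thesis by simp
qed

text \<open>
  Data processing for the truncated expected log likelihood ratio, from
  \<open>ln z \<le> z - 1\<close> for the quotient of the previous lemma. With \<open>K = 0\<close> it says that the
  Kullback-Leibler divergence does not increase; with large \<open>K\<close> it controls the upper tail of the log
  likelihood ratio of the images, for all maps \<open>T\<close> simultaneously.
\<close>
lemma ln_likelihood_ratio_pushforward:
  fixes D :: "'a \<Rightarrow> real" and r :: "'b \<Rightarrow> real"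
  assumes D[measurable]: "D \<in> borel_measurable P" and Q: "prob_space (density P D)"
    and T[measurable]: "T \<in> measurable P N" and r[measurable]: "r \<in> borel_measurable N"
    and nn: "\<And>x. 0 \<le> D x" "\<And>y. 0 \<le> r y"
    and eq: "distr (density P D) N T = density (distr P N T) r"
    and K: "0 \<le> K"
    and int: "integrable (density P D) (\<lambda>x. ln (max (D x) K))"
  shows "0 < K \<Longrightarrow> integrable (density P D) (\<lambda>x. ln (max (r (T x)) K))"
    and "0 < K \<or> integrable (density P D) (\<lambda>x. ln (max (r (T x)) K)) \<Longrightarrow>
      (\<integral>x. ln (max (r (T x)) K) \<partial>density P D) \<le> (\<integral>x. ln (max (D x) K) \<partial>density P D)"
proof -
  let ?Q = "density P D"
  interpret Q: prob_space ?Q by fact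
  let ?Z = "\<lambda>x. max (r (T x)) K / max (D x) K"
  have Z1: "(\<integral>\<^sup>+x. ennreal (?Z x) \<partial>?Q) \<le> 1"
    by (rule likelihood_ratio_pushforward) fact+
  have Z0: "0 \<le> ?Z x" for x using nn K by (intro divide_nonneg_nonneg) (auto simp: max_def)
  have Zint: "integrable ?Q ?Z"
    using Z1 Z0 by (intro integrableI_nonneg) (auto simp: le_less_trans)
  have Zle: "(\<integral>x. ?Z x \<partial>?Q) \<le> 1"
    using Z1 Z0 by (subst integral_eq_nn_integral) (auto intro!: enn2real_leI)
  have posD: "AE x in ?Q. 0 < D x"
    using nn(1) by (subst AE_density) (auto simp: less_le)
  have posr: "AE x in ?Q. 0 < r (T x)"
  proof -
    have "AE y in density (distr P N T) r. 0 < r y"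
      using nn(2) by (subst AE_density) (auto simp: less_le)
    then show ?thesis unfolding eq[symmetric] by (subst (asm) AE_distr_iff) auto
  qed
  have bound: "AE x in ?Q. ln (max (r (T x)) K) \<le> ln (max (D x) K) + ?Z x - 1"
    using posD posr
  proof eventually_elim
    case (elim x)
    then have pos: "0 < max (r (T x)) K" "0 < max (D x) K" by auto
    then have "ln (?Z x) \<le> ?Z x - 1" by (intro ln_le_minus_one) auto
    then show ?case using pos by (simp add: ln_div)
  qed
  show int1: "integrable ?Q (\<lambda>x. ln (max (r (T x)) K))" if "0 < K"
  proof (rule Bochner_Integration.integrable_bound)
    show "integrable ?Q (\<lambda>x. \<bar>ln (max (D x) K)\<bar> + ?Z x + 1 + \<bar>ln K\<bar>)" using int Zint by auto
    show "AE x in ?Q. norm (ln (max (r (T x)) K)) \<le> norm (\<bar>ln (max (D x) K)\<bar> + ?Z x + 1 + \<bar>ln K\<bar>)"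
      using bound
    proof eventually_elim
      case (elim x)
      have "ln K \<le> ln (max (r (T x)) K)" using that by simp
      moreover have "\<bar>y\<bar> \<le> \<bar>\<bar>a\<bar> + z + 1 + \<bar>l\<bar>\<bar>" if "l \<le> y" "y \<le> a + z - 1" "0 \<le> z"
        for y a z l :: real using that by linarith
      ultimately show ?case using elim Z0[of x] by simp
    qed
  qed measurable
  assume "0 < K \<or> integrable ?Q (\<lambda>x. ln (max (r (T x)) K))"
  then have int2: "integrable ?Q (\<lambda>x. ln (max (r (T x)) K))" using int1 by blast
  have "(\<integral>x. ln (max (r (T x)) K) \<partial>?Q) \<le> (\<integral>x. ln (max (D x) K) + ?Z x - 1 \<partial>?Q)"
    using bound int2 int Zint by (intro integral_mono_AE) auto
  also have "\<dots> = (\<integral>x. ln (max (D x) K) \<partial>?Q) + (\<integral>x. ?Z x \<partial>?Q) - 1"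
    using int Zint by (simp add: Q.prob_space[simplified])
  finally show "(\<integral>x. ln (max (r (T x)) K) \<partial>?Q) \<le> (\<integral>x. ln (max (D x) K) \<partial>?Q)"
    using Zle by simp
qed

text \<open>
  Up to the level \<open>K\<^sup>2\<close> the function \<open>r ln r\<close> is bounded by a multiple of \<open>\<bar>r - 1\<bar>\<close>; above it,
  \<open>ln r \<le> 2 (ln r - ln K)\<close>.
\<close>
lemma xlnx_bounds:
  fixes r K :: real
  assumes r: "0 \<le> r" and K: "1 < K"
  shows "r - 1 \<le> r * ln r"
    and "r * ln r \<le> K\<^sup>2 * \<bar>r - 1\<bar> + 2 * (r * (ln (max r K) - ln K))"
proof -
  show "r - 1 \<le> r * ln r"
  proof (cases "r = 0")
    case False
    then have "0 < r" using r by simp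
    then have "ln (1 / r) \<le> 1 / r - 1" by (intro ln_le_minus_one) auto
    then have "1 - 1 / r \<le> ln r" using \<open>0 < r\<close> by (simp add: ln_div)
    then have "r * (1 - 1 / r) \<le> r * ln r" using r by (intro mult_left_mono) auto
    moreover have "r * (1 - 1 / r) = r - 1" using \<open>0 < r\<close> by (simp add: field_simps)
    ultimately show ?thesis by simp
  qed simp
  have nn: "0 \<le> 2 * (r * (ln (max r K) - ln K))" "0 \<le> K\<^sup>2 * \<bar>r - 1\<bar>"
    using r K by (auto intro!: mult_nonneg_nonneg)
  consider "r \<le> 1" | "1 < r" "r \<le> K\<^sup>2" | "1 < r" "K\<^sup>2 < r" by linarith
  then show "r * ln r \<le> K\<^sup>2 * \<bar>r - 1\<bar> + 2 * (r * (ln (max r K) - ln K))"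
  proof cases
    case 1
    then have "r * ln r \<le> 0" using r by (cases "r = 0") (auto intro!: mult_nonneg_nonpos)
    then show ?thesis using nn by linarith
  next
    case 2
    have "r * ln r \<le> r * (r - 1)" using 2 by (intro mult_left_mono ln_le_minus_one) auto
    also have "\<dots> \<le> K\<^sup>2 * (r - 1)" using 2 by (intro mult_right_mono) auto
    finally show ?thesis using nn 2 by simp
  next
    case 3
    have "K < K\<^sup>2" using K by (simp add: power2_eq_square)
    then have m: "max r K = r" using 3 by simp
    have "ln (K\<^sup>2) \<le> ln r" using 3 K by (subst ln_le_cancel_iff) auto
    then have "2 * ln K \<le> ln r" using K by (simp add: ln_realpow)
    then have "r * ln r \<le> r * (2 * (ln r - ln K))" using r by (intro mult_left_mono) auto
    then have "r * ln r \<le> 2 * (r * (ln (max r K) - ln K))" unfolding m by (simp add: algebra_simps)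
    then show ?thesis using nn by linarith
  qed
qed

text \<open>
  Small total variation alone does not make a divergence small. This quantifies what is missing: the
  second term is the mean excess of the log likelihood ratio over \<open>ln K\<close>.
\<close>
lemma expected_ln_density_le:
  fixes r :: "'a \<Rightarrow> real"
  assumes P: "prob_space P" and r[measurable]: "r \<in> borel_measurable P" "\<And>x. 0 \<le> r x"
    and Q: "prob_space (density P r)"
    and tv: "\<And>A. A \<in> sets P \<Longrightarrow> \<bar>measure (density P r) A - measure P A\<bar> \<le> c"
    and K: "1 < K" and int: "integrable (density P r) (\<lambda>x. ln (max (r x) K))"
  shows "integrable (density P r) (\<lambda>x. ln (r x))"
    and "(\<integral>x. ln (r x) \<partial>density P r)
      \<le> 2 * K\<^sup>2 * c + 2 * ((\<integral>x. ln (max (r x) K) \<partial>density P r) - ln K)"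
proof -
  interpret P: prob_space P by fact
  interpret Q: prob_space "density P r" by fact
  have r_int: "integrable P r" using r Q by (rule integrable_prob_density)
  note meas = measure_eq_integral_density[OF r]
  let ?A = "{x \<in> space P. 1 \<le> r x}" and ?B = "{x \<in> space P. r x < 1}"
  have ind: "integrable P (\<lambda>x. indicator A x * r x)" "integrable P (indicator A :: _ \<Rightarrow> real)"
    if [measurable]: "A \<in> sets P" for A
    using integrable_mult_indicator[OF that r_int] by (auto simp: less_top[symmetric])
  have "(\<integral>x. \<bar>r x - 1\<bar> \<partial>P)
      = (\<integral>x. (indicator ?A x * r x - indicator ?A x) - (indicator ?B x * r x - indicator ?B x) \<partial>P)"
    by (intro Bochner_Integration.integral_cong) (auto simp: indicator_def)
  also have "\<dots> = (measure (density P r) ?A - measure P ?A) - (measure (density P r) ?B - measure P ?B)"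
    using ind[of ?A] ind[of ?B] by (simp add: meas)
  also have "\<dots> \<le> 2 * c" using tv[of ?A] tv[of ?B] by auto
  finally have l1: "(\<integral>x. \<bar>r x - 1\<bar> \<partial>P) \<le> 2 * c" .
  have int1: "integrable P (\<lambda>x. r x * (ln (max (r x) K) - ln K))"
  proof -
    have "integrable P (\<lambda>x. r x * ln (max (r x) K))"
      using int r by (subst (asm) integrable_real_density) auto
    then show ?thesis using r_int by (simp add: right_diff_distrib)
  qed
  have int2: "integrable P (\<lambda>x. r x * ln (r x))"
  proof (rule Bochner_Integration.integrable_bound)
    show "integrable P (\<lambda>x. (K\<^sup>2 + 1) * \<bar>r x - 1\<bar> + 2 * (r x * (ln (max (r x) K) - ln K)))"
      using int1 r_int by auto
    show "AE x in P. norm (r x * ln (r x))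
        \<le> norm ((K\<^sup>2 + 1) * \<bar>r x - 1\<bar> + 2 * (r x * (ln (max (r x) K) - ln K)))"
    proof (rule AE_I2)
      fix x
      have le: "\<bar>y\<bar> \<le> \<bar>a + \<bar>b\<bar> + 2 * e\<bar>"
        if "b \<le> y" "y \<le> a + 2 * e" "0 \<le> a" "0 \<le> e" for y a b e :: real
        using that by linarith
      have "0 \<le> r x * (ln (max (r x) K) - ln K)" "0 \<le> K\<^sup>2 * \<bar>r x - 1\<bar>"
        using r(2)[of x] K by (auto intro!: mult_nonneg_nonneg)
      then show "norm (r x * ln (r x))
          \<le> norm ((K\<^sup>2 + 1) * \<bar>r x - 1\<bar> + 2 * (r x * (ln (max (r x) K) - ln K)))"
        using xlnx_bounds[OF r(2)[of x] K] unfolding real_norm_def distrib_right mult_1_left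
        by (intro le) auto
    qed
  qed measurable
  show "integrable (density P r) (\<lambda>x. ln (r x))"
    using int2 r by (subst integrable_real_density) auto
  have "(\<integral>x. ln (r x) \<partial>density P r) = (\<integral>x. r x * ln (r x) \<partial>P)"
    using r by (subst integral_real_density) auto
  also have "\<dots> \<le> (\<integral>x. K\<^sup>2 * \<bar>r x - 1\<bar> + 2 * (r x * (ln (max (r x) K) - ln K)) \<partial>P)"
    using xlnx_bounds(2)[OF r(2) K] int1 int2 r_int by (intro integral_mono) auto
  also have "\<dots> = K\<^sup>2 * (\<integral>x. \<bar>r x - 1\<bar> \<partial>P) + 2 * (\<integral>x. r x * (ln (max (r x) K) - ln K) \<partial>P)"
    using int1 r_int by simp
  also have "(\<integral>x. r x * (ln (max (r x) K) - ln K) \<partial>P) = (\<integral>x. ln (max (r x) K) - ln K \<partial>density P r)"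
    using r by (subst integral_real_density) auto
  also have "\<dots> = (\<integral>x. ln (max (r x) K) \<partial>density P r) - ln K"
    using int by (simp add: Q.prob_space[simplified])
  finally show "(\<integral>x. ln (r x) \<partial>density P r)
      \<le> 2 * K\<^sup>2 * c + 2 * ((\<integral>x. ln (max (r x) K) \<partial>density P r) - ln K)"
    using mult_left_mono[OF l1, of "K\<^sup>2"] by simp
qed

section \<open>Asymptotically right invariant distributions\<close>

text \<open>
  For \<open>s\<close> in the unit interval, the largest multiple of \<open>1/n\<close> that does not exceed \<open>s\<close>, written as a
  sum of indicators of half-lines.
\<close>
definition staircase :: "nat \<Rightarrow> real \<Rightarrow> real" where
  "staircase n s = (\<Sum>i=1..n. indicator {real i / real n..} s) / real n"

lemma staircase_approx:
  assumes n: "0 < n" and s: "0 \<le> s" "s \<le> 1"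
  shows "\<bar>s - staircase n s\<bar> \<le> 1 / real n"
proof -
  have "(\<Sum>i=1..n. indicator {real i / real n..} s :: real) = (\<Sum>i=1..n. if int i \<le> \<lfloor>n * s\<rfloor> then 1 else 0)"
  proof (rule sum.cong[OF refl])
    fix i
    have "real i / real n \<le> s \<longleftrightarrow> real i \<le> n * s" using n by (simp add: field_simps)
    also have "\<dots> \<longleftrightarrow> int i \<le> \<lfloor>n * s\<rfloor>" by (simp add: le_floor_iff)
    finally show "indicator {real i / real n..} s = (if int i \<le> \<lfloor>n * s\<rfloor> then 1 else 0 :: real)"
      by (simp add: indicator_def)
  qed
  also have "\<dots> = real (card {i \<in> {1..n}. int i \<le> \<lfloor>n * s\<rfloor>})"
    by (subst sum.inter_filter[symmetric]) auto
  also have "{i \<in> {1..n}. int i \<le> \<lfloor>n * s\<rfloor>} = {1..nat \<lfloor>n * s\<rfloor>}"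
  proof -
    have "real n * s \<le> real n * 1" using s by (intro mult_left_mono) auto
    then have "\<lfloor>n * s\<rfloor> \<le> int n" by (simp add: floor_le_iff)
    then show ?thesis by auto
  qed
  also have "real (card {1..nat \<lfloor>n * s\<rfloor>}) = of_int \<lfloor>n * s\<rfloor>" using s by simp
  finally have e: "staircase n s = of_int \<lfloor>n * s\<rfloor> / n" by (simp add: staircase_def)
  have "s - staircase n s = (n * s - of_int \<lfloor>n * s\<rfloor>) / n" using n by (simp add: e field_simps)
  moreover have "\<bar>n * s - of_int \<lfloor>n * s\<rfloor>\<bar> \<le> 1" by linarith
  ultimately show ?thesis using n by (simp add: divide_right_mono)
qed

text \<open>
  Asymptotic invariance on sets passes to bounded functions by uniform approximation: up to \<open>1/n\<close>,
  the function is the mean of the indicators of \<open>n\<close> of its superlevel sets.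
\<close>
lemma asymptotic_invariance_integral:
  fixes \<pi> :: "nat \<Rightarrow> 'g::{topological_group_add, second_countable_topology} measure"
    and \<psi> :: "'g \<Rightarrow> real"
  assumes \<pi>: "\<And>k. \<pi> k \<in> space (prob_algebra borel)"
    and inv: "\<And>B g. B \<in> sets borel \<Longrightarrow>
      (\<lambda>k. \<bar>measure (\<pi> k) B - measure (\<pi> k) ((\<lambda>b. b + g) ` B)\<bar>) \<longlonglongrightarrow> 0"
    and \<psi>: "\<psi> \<in> borel_measurable borel" "\<And>x. 0 \<le> \<psi> x" "\<And>x. \<psi> x \<le> 1"
  shows "(\<lambda>k. (\<integral>x. \<psi> (x + g) \<partial>\<pi> k) - (\<integral>x. \<psi> x \<partial>\<pi> k)) \<longlonglongrightarrow> 0"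
proof -
  have prob: "prob_space (\<pi> k)" for k using \<pi>[of k] by (simp add: space_prob_algebra)
  have sets[measurable_cong, simp]: "sets (\<pi> k) = sets borel" for k
    using \<pi>[of k] by (simp add: space_prob_algebra)
  have space[simp]: "space (\<pi> k) = UNIV" for k using sets_eq_imp_space_eq[OF sets] by simp
  have tr[measurable]: "(\<lambda>x. x + g) \<in> borel_measurable borel"
    by (intro borel_measurable_continuous_onI continuous_intros)
  note \<psi>(1)[measurable]
  define B where "B n i = \<psi> -` {real i / real n..}" for n i :: nat
  have B[measurable]: "B n i \<in> sets borel" for n i
    using measurable_sets[OF \<psi>(1), of "{real i / real n..}"] by (simp add: B_def)
  have shift: "(\<lambda>x. x + g) -` B n i = (\<lambda>b. b + - g) ` B n i" for n i
  proof (intro set_eqI iffI)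
    fix x assume "x \<in> (\<lambda>x. x + g) -` B n i"
    then have "(x + g) + - g \<in> (\<lambda>b. b + - g) ` B n i" by blast
    then show "x \<in> (\<lambda>b. b + - g) ` B n i" by (simp add: add.assoc)
  qed (auto simp: add.assoc)
  have Bg[measurable]: "(\<lambda>x. x + g) -` B n i \<in> sets borel" for n i
    using measurable_sets[OF tr B, of n i] by simp
  define \<Delta> where "\<Delta> k n = (\<Sum>i=1..n. measure (\<pi> k) ((\<lambda>b. b + - g) ` B n i) - measure (\<pi> k) (B n i)) / real n"
    for k n
  have \<Delta>_lim: "(\<lambda>k. \<Delta> k n) \<longlonglongrightarrow> 0" for n
  proof -
    have "(\<lambda>k. measure (\<pi> k) ((\<lambda>b. b + - g) ` B n i) - measure (\<pi> k) (B n i)) \<longlonglongrightarrow> 0" for i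
      using inv[OF B, of n i "- g"]
      by (subst (asm) abs_minus_commute) (simp only: tendsto_rabs_zero_iff)
    then have "(\<lambda>k. \<Delta> k n) \<longlonglongrightarrow> (\<Sum>i=1..n. 0) / real n"
      unfolding \<Delta>_def by (intro tendsto_divide_zero[of _ _ "real n"] tendsto_sum
          | simp add: divide_inverse tendsto_mult_left_zero tendsto_null_sum)+
    then show ?thesis by simp
  qed
  have approx: "\<bar>(\<integral>x. \<psi> (x + g) \<partial>\<pi> k) - (\<integral>x. \<psi> x \<partial>\<pi> k) - \<Delta> k n\<bar> \<le> 2 / real n"
    if n: "0 < n" for k n
  proof -
    interpret prob_space "\<pi> k" by (rule prob)
    have int_st: "integrable (\<pi> k) (\<lambda>x. staircase n (f x))" "integrable (\<pi> k) f"
      "(\<integral>x. staircase n (f x) \<partial>\<pi> k) = (\<Sum>i=1..n. measure (\<pi> k) (f -` {real i / real n..})) / real n"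
      if f: "f \<in> borel_measurable borel" "\<And>x. 0 \<le> f x" "\<And>x. f x \<le> 1" for f
    proof -
      have s: "f -` {real i / real n..} \<in> sets borel" for i
        using measurable_sets[OF f(1), of "{real i / real n..}"] by simp
      have e: "staircase n (f x) = (\<Sum>i=1..n. indicator (f -` {real i / real n..}) x) / real n" for x
        unfolding staircase_def by (simp add: indicator_def)
      have ii: "integrable (\<pi> k) (indicator (f -` {real i / real n..}) :: _ \<Rightarrow> real)" for i
        using s by (simp add: less_top[symmetric])
      show "integrable (\<pi> k) (\<lambda>x. staircase n (f x))" unfolding e using ii by auto
      show "integrable (\<pi> k) f"
        using f by (intro integrable_const_bound[where B = 1]) (auto simp: measurable_cong_sets[OF sets refl])
      show "(\<integral>x. staircase n (f x) \<partial>\<pi> k) = (\<Sum>i=1..n. measure (\<pi> k) (f -` {real i / real n..})) / real n"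
        unfolding e using ii by simp
    qed
    have close: "\<bar>(\<integral>x. f x \<partial>\<pi> k) - (\<integral>x. staircase n (f x) \<partial>\<pi> k)\<bar> \<le> 1 / real n"
      if f: "f \<in> borel_measurable borel" "\<And>x. 0 \<le> f x" "\<And>x. f x \<le> 1" for f
    proof -
      have "\<bar>(\<integral>x. f x \<partial>\<pi> k) - (\<integral>x. staircase n (f x) \<partial>\<pi> k)\<bar> = \<bar>\<integral>x. f x - staircase n (f x) \<partial>\<pi> k\<bar>"
        using int_st(1,2)[OF f] by simp
      also have "\<dots> \<le> (\<integral>x. \<bar>f x - staircase n (f x)\<bar> \<partial>\<pi> k)" by (rule integral_abs_bound)
      also have "\<dots> \<le> (\<integral>x. 1 / real n \<partial>\<pi> k)"
        using int_st(1,2)[OF f] staircase_approx[OF n] f by (intro integral_mono) auto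
      finally show ?thesis by (simp add: prob_space[simplified])
    qed
    have g: "(\<lambda>x. \<psi> (x + g)) \<in> borel_measurable borel" by measurable
    have "\<Delta> k n = (\<integral>x. staircase n (\<psi> (x + g)) \<partial>\<pi> k) - (\<integral>x. staircase n (\<psi> x) \<partial>\<pi> k)"
      unfolding int_st(3)[OF g \<psi>(2,3)] int_st(3)[OF \<psi>] \<Delta>_def
        shift[symmetric] B_def[symmetric]
      by (simp add: sum_subtractf diff_divide_distrib B_def vimage_def)
    then show ?thesis using close[OF g \<psi>(2,3)] close[OF \<psi>] by (simp add: abs_le_iff)
  qed
  show ?thesis
  proof (rule LIMSEQ_I)
    fix e :: real assume e: "0 < e"
    obtain n where n: "0 < n" "4 / e < real n"
      using reals_Archimedean2[of "max (4/e) 0"] by (metis max_less_iff_conj of_nat_0_less_iff)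
    then have n2: "2 / real n < e / 2" using e by (simp add: field_simps)
    obtain k0 where k0: "\<And>k. k0 \<le> k \<Longrightarrow> \<bar>\<Delta> k n\<bar> < e / 2"
      using LIMSEQ_D[OF \<Delta>_lim[of n], of "e / 2"] e by auto
    show "\<exists>k0. \<forall>k\<ge>k0. norm ((\<integral>x. \<psi> (x + g) \<partial>\<pi> k) - (\<integral>x. \<psi> x \<partial>\<pi> k) - 0) < e"
    proof (intro exI allI impI)
      fix k assume "k0 \<le> k"
      then show "norm ((\<integral>x. \<psi> (x + g) \<partial>\<pi> k) - (\<integral>x. \<psi> x \<partial>\<pi> k) - 0) < e"
        using approx[OF n(1), of k] n2 k0[of k] unfolding real_norm_def by linarith
    qed
  qed
qed

section \<open>Borel coordinates along the orbits of a free proper action\<close>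

lemma compact_convergent_sequence:
  fixes x :: "nat \<Rightarrow> 'a::topological_space"
  assumes lim: "x \<longlonglongrightarrow> l"
  shows "compact (insert l (range x))"
  unfolding compact_eq_Heine_Borel
proof (intro allI impI, elim conjE)
  fix C assume C: "\<forall>U\<in>C. open U" "insert l (range x) \<subseteq> \<Union>C"
  then obtain U where U: "U \<in> C" "l \<in> U" by auto
  then obtain N where N: "\<And>n. N \<le> n \<Longrightarrow> x n \<in> U"
    using topological_tendstoD[OF lim, of U] C(1) by (auto simp: eventually_sequentially)
  have "\<forall>n. \<exists>V. V \<in> C \<and> x n \<in> V" using C(2) by blast
  then obtain V where V: "\<And>n. V n \<in> C" "\<And>n. x n \<in> V n" by metis
  have "x n \<in> U \<union> (\<Union>k<N. V k)" for n using N[of n] V(2)[of n] by (cases "n < N") auto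
  then have "insert l (range x) \<subseteq> \<Union>(insert U (V ` {..<N}))" using U(2) by auto
  moreover have "insert U (V ` {..<N}) \<subseteq> C" "finite (insert U (V ` {..<N}))" using U V by auto
  ultimately show "\<exists>C'\<subseteq>C. finite C' \<and> insert l (range x) \<subseteq> \<Union>C'" by blast
qed

locale free_proper_action =
  fixes act :: "'g::{topological_group_add, polish_space} \<Rightarrow> 'y::polish_space \<Rightarrow> 'y"
  assumes action: "is_action act"
    and free: "free_action act"
    and cont: "continuous_action act"
    and proper: "proper_action act"
begin

lemma act_zero [simp]: "act 0 y = y"
  and act_add: "act (g + h) y = act g (act h y)"
  using action unfolding is_action_def by auto

lemma act_inverse [simp]: "act g (act (- g) y) = y" "act (- g) (act g y) = y"
  by (simp_all flip: act_add)

lemma act_cancel: "act g y = act h y \<Longrightarrow> g = h"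
proof -
  assume "act g y = act h y"
  then have "act (- h + g) y = y" by (simp add: act_add)
  then have "- h + g = 0" using free unfolding free_action_def by blast
  then have "h + (- h + g) = h" by simp
  then show "g = h" by (simp flip: add.assoc)
qed

lemma act_measurable_pair: "(\<lambda>(g, y). act g y) \<in> borel_measurable (borel \<Otimes>\<^sub>M borel)"
  using cont unfolding continuous_action_def borel_prod by (intro borel_measurable_continuous_onI)

lemma act_measurable [measurable]: "act g \<in> borel_measurable borel"
  using measurable_Pair2[OF act_measurable_pair, of g] by simp

lemma act_measurable_left: "(\<lambda>g. act g y) \<in> borel_measurable borel"
  using measurable_Pair1[OF act_measurable_pair, of y] by simp

text \<open>
  Proper maps into a metric space are closed: the inverse image of a convergent sequence together
  with its limit is compact. With \<open>C\<close> the whole group this says that the orbit relation is closed;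
  with smaller \<open>C\<close>, that for a free action the group element that moves one point of an orbit to
  another depends continuously on the pair.
\<close>
lemma closed_orbit_relation:
  assumes C: "closed C"
  shows "closed ((\<lambda>(g, y). (act g y, y)) ` (C \<times> UNIV))"
  unfolding closed_sequential_limits
proof (intro allI impI, elim conjE)
  fix x l
  let ?f = "\<lambda>(g, y). (act g y, y)"
  assume x: "\<forall>n. x n \<in> ?f ` (C \<times> UNIV)" and lim: "x \<longlonglongrightarrow> l"
  have f_cont: "continuous_on UNIV ?f"
    using continuous_on_Pair[OF cont[unfolded continuous_action_def] continuous_on_snd[OF continuous_on_id]]
    by (simp add: case_prod_unfold)
  have "\<forall>n. \<exists>gy. gy \<in> C \<times> UNIV \<and> x n = ?f gy" using x by blast
  then obtain z where "\<forall>n. z n \<in> C \<times> UNIV \<and> x n = ?f (z n)" by (rule choice[THEN exE])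
  then have z: "\<And>n. z n \<in> C \<times> UNIV" "\<And>n. x n = ?f (z n)" by auto
  have "compact (insert l (range x))" using lim by (rule compact_convergent_sequence)
  then have "compact (?f -` insert l (range x))" using proper unfolding proper_action_def by blast
  then have "seq_compact (?f -` insert l (range x))" by (rule compact_imp_seq_compact)
  moreover have "\<forall>n. z n \<in> ?f -` insert l (range x)"
  proof
    fix n
    have "?f (z n) \<in> insert l (range x)" unfolding z(2)[symmetric] by simp
    then show "z n \<in> ?f -` insert l (range x)" by (rule vimageI2)
  qed
  ultimately obtain a r where r: "strict_mono r" "(z \<circ> r) \<longlonglongrightarrow> a"
    unfolding seq_compact_def by blast
  have "closed (C \<times> (UNIV :: 'y set))" using C by (intro closed_Times) auto
  then have a: "a \<in> C \<times> UNIV" using closed_sequentially[OF _ _ r(2)] z(1) by auto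
  have "(\<lambda>n. ?f ((z \<circ> r) n)) \<longlonglongrightarrow> ?f a"
    using continuous_on_tendsto_compose[OF f_cont r(2)] by simp
  moreover have "(\<lambda>n. ?f ((z \<circ> r) n)) = x \<circ> r" unfolding comp_def z(2) ..
  ultimately have "(x \<circ> r) \<longlonglongrightarrow> ?f a" by simp
  then have "?f a = l" using LIMSEQ_subseq_LIMSEQ[OF lim r(1)] by (rule LIMSEQ_unique)
  then show "l \<in> ?f ` (C \<times> UNIV)" using a by blast
qed

definition orbit :: "'y \<Rightarrow> 'y set" where
  "orbit y = range (\<lambda>g. act g y)"

lemma orbit_act [simp]: "orbit (act g y) = orbit y"
proof -
  have "orbit (act g y) \<subseteq> orbit y" for g y unfolding orbit_def by (auto simp flip: act_add)
  from this[of g y] this[of "- g" "act g y"] show ?thesis by simp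
qed

lemma closed_orbit: "closed (orbit y)"
proof -
  have "orbit y = (\<lambda>x. (x, y)) -` ((\<lambda>(g, y). (act g y, y)) ` (UNIV \<times> UNIV))"
    unfolding orbit_def by (auto simp: image_iff)
  moreover have "continuous_on UNIV (\<lambda>x. (x, y))" by (intro continuous_intros)
  ultimately show ?thesis using closed_vimage[OF closed_orbit_relation[OF closed_UNIV]] by simp
qed

lemma open_orbit_meets: "open U \<Longrightarrow> open {y. orbit y \<inter> U \<noteq> {}}"
proof -
  assume U: "open U"
  have "continuous_on UNIV (act g)" for g
  proof -
    have "continuous_on UNIV (\<lambda>y. (g, y))" by (intro continuous_intros)
    then show ?thesis
      using continuous_on_compose2[OF cont[unfolded continuous_action_def], of UNIV "\<lambda>y. (g, y)"]
      by simp
  qed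
  then have "open (act g -` U)" for g using U by (rule open_vimage[rotated])
  moreover have "{y. orbit y \<inter> U \<noteq> {}} = (\<Union>g. act g -` U)" unfolding orbit_def by auto
  ultimately show ?thesis by auto
qed

text \<open>
  The selection procedure of Kuratowski and Ryll-Nardzewski, applied to the closed sets \<open>orbit y\<close>:
  the chosen point is the limit of centres \<open>e (i k y)\<close> of balls of radius \<open>2\<^sup>-\<^sup>k\<close> that meet the orbit,
  each with the least index for which its ball meets the orbit inside the previous ball. The
  procedure only uses the orbit as a set, so its result is invariant; it is Borel because the set of
  points whose orbit meets an open set is open.
\<close>
lemma measurable_orbit_selector:
  obtains s where "s \<in> borel_measurable borel" "\<And>g y. s (act g y) = s y" "\<And>y. s y \<in> orbit y"
proof -
  obtain D :: "'y set" where D: "countable D" "\<And>X. open X \<Longrightarrow> X \<noteq> {} \<Longrightarrow> \<exists>d\<in>D. d \<in> X"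
    by (rule countable_dense_setE) blast
  have Dne: "D \<noteq> {}" using D(2)[of UNIV] by auto
  define e where "e = from_nat_into D"
  define B where "B k n = ball (e n) ((1/2)^k)" for k n :: nat
  have dense: "\<exists>n. y \<in> B k n" for y k
  proof -
    obtain d where "d \<in> D" "d \<in> ball y ((1/2)^k)"
      using D(2)[OF open_ball, of y "(1/2)^k"] by (auto simp: not_le)
    moreover then obtain n where "d = e n"
      unfolding e_def using from_nat_into_surj[OF D(1)] by metis
    ultimately show ?thesis unfolding B_def by (auto simp: dist_commute)
  qed
  have B_open: "open (B k n)" for k n unfolding B_def by simp
  define i where "i = rec_nat (\<lambda>y. LEAST n. orbit y \<inter> B 0 n \<noteq> {})
    (\<lambda>k f y. LEAST n. orbit y \<inter> (B (Suc k) n \<inter> B k (f y)) \<noteq> {})"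
  have i0: "i 0 y = (LEAST n. orbit y \<inter> B 0 n \<noteq> {})"
    and iS: "i (Suc k) y = (LEAST n. orbit y \<inter> (B (Suc k) n \<inter> B k (i k y)) \<noteq> {})" for k y
    unfolding i_def by auto
  have meets: "\<And>k. orbit y \<inter> B k (i k y) \<noteq> {}"
    and meets2: "\<And>k. orbit y \<inter> (B (Suc k) (i (Suc k) y) \<inter> B k (i k y)) \<noteq> {}" for y
  proof -
    have step: "orbit y \<inter> (B (Suc k) (i (Suc k) y) \<inter> B k (i k y)) \<noteq> {}"
      if m: "orbit y \<inter> B k (i k y) \<noteq> {}" for k
    proof -
      obtain x where x: "x \<in> orbit y" "x \<in> B k (i k y)" using m by blast
      obtain n where "x \<in> B (Suc k) n" using dense by blast
      then have "orbit y \<inter> (B (Suc k) n \<inter> B k (i k y)) \<noteq> {}" using x by blast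
      then show ?thesis unfolding iS by (rule LeastI)
    qed
    show m: "orbit y \<inter> B k (i k y) \<noteq> {}" for k
    proof (induction k)
      case 0
      obtain n where "y \<in> B 0 n" using dense by blast
      moreover have "y \<in> orbit y" unfolding orbit_def using act_zero[of y] by (metis rangeI)
      ultimately have "orbit y \<inter> B 0 n \<noteq> {}" by blast
      then show ?case unfolding i0 by (rule LeastI)
    qed (use step in blast)
    show "orbit y \<inter> (B (Suc k) (i (Suc k) y) \<inter> B k (i k y)) \<noteq> {}" for k using step[OF m] .
  qed
  have i_inv: "i k (act g y) = i k y" for k g y by (induction k) (simp_all add: i0 iS)
  have i_meas[measurable]: "i k \<in> measurable borel (count_space UNIV)" for k
  proof (induction k)
    case 0
    have "Measurable.pred borel (\<lambda>y. orbit y \<inter> B 0 n \<noteq> {})" for n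
      using borel_open[OF open_orbit_meets[OF B_open]] by (simp add: pred_def)
    then show ?case unfolding i0[abs_def] by measurable
  next
    case (Suc k)
    note Suc[measurable]
    have p: "Measurable.pred borel (\<lambda>y. orbit y \<inter> (B (Suc k) n \<inter> B k j) \<noteq> {})" for n j
      using borel_open[OF open_orbit_meets[OF open_Int[OF B_open B_open]]] by (simp add: pred_def)
    have "Measurable.pred borel (\<lambda>y. orbit y \<inter> (B (Suc k) n \<inter> B k (i k y)) \<noteq> {})" for n
      by (rule measurable_compose_countable[OF p Suc])
    then show ?case unfolding iS[abs_def] by measurable
  qed
  define s where "s y = lim (\<lambda>k. e (i k y))" for y
  have step: "dist (e (i k y)) (e (i (Suc k) y)) \<le> 2 * (1/2)^k" for k y
  proof -
    obtain x where "x \<in> B (Suc k) (i (Suc k) y)" "x \<in> B k (i k y)" using meets2 by blast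
    then have "dist (e (i (Suc k) y)) x < (1/2)^k / 2" "dist (e (i k y)) x < (1/2)^k"
      unfolding B_def by auto
    moreover have "0 \<le> (1/2 :: real)^k" by simp
    ultimately show ?thesis
      using dist_triangle2[of "e (i k y)" "e (i (Suc k) y)" x] by linarith
  qed
  have geo: "dist (e (i k y)) (e (i (k + j) y)) \<le> 4 * (1/2)^k - 4 * (1/2)^(k + j)" for k j y
  proof (induction j)
    case (Suc j)
    show ?case
    proof -
      have "(1/2 :: real)^(k + j) = 2 * (1/2)^(k + Suc j)" by simp
      moreover have "dist (e (i (k + j) y)) (e (i (k + Suc j) y)) \<le> 2 * (1/2)^(k + j)"
        using step[of "k + j" y] by (simp only: add_Suc_right)
      ultimately show ?thesis
        using Suc dist_triangle[of "e (i k y)" "e (i (k + Suc j) y)" "e (i (k + j) y)"] by linarith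
    qed
  qed simp
  have cauchy: "Cauchy (\<lambda>k. e (i k y))" for y
  proof (rule metric_CauchyI)
    fix \<epsilon> :: real assume \<epsilon>: "0 < \<epsilon>"
    obtain N where N: "(1/2)^N < \<epsilon> / 8" using real_arch_pow_inv[of "\<epsilon> / 8" "1/2"] \<epsilon> by auto
    have half: "dist (e (i N y)) (e (i m y)) < \<epsilon> / 2" if "N \<le> m" for m
    proof -
      have "dist (e (i N y)) (e (i m y)) \<le> 4 * (1/2)^N - 4 * (1/2)^m"
        using geo[of N y "m - N"] that by simp
      moreover have "0 \<le> (1/2 :: real)^m" by simp
      ultimately show ?thesis using N by linarith
    qed
    have N': "dist (e (i m y)) (e (i n y)) < \<epsilon>" if "N \<le> m" "N \<le> n" for m n
      by (rule dist_triangle_half_r[of "e (i N y)"]) (use that half in auto)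
    show "\<exists>N. \<forall>m\<ge>N. \<forall>n\<ge>N. dist (e (i m y)) (e (i n y)) < \<epsilon>"
      by (rule exI[of _ N]) (simp add: N')
  qed
  then have s_lim: "(\<lambda>k. e (i k y)) \<longlonglongrightarrow> s y" for y
    unfolding s_def using Cauchy_convergent_iff[of "\<lambda>k. e (i k y)"]
    by (simp add: convergent_LIMSEQ_iff)
  have "s y \<in> orbit y" for y
  proof -
    have "\<exists>x. x \<in> orbit y \<and> dist x (e (i k y)) < (1/2)^k" for k
    proof -
      obtain x where "x \<in> orbit y" "x \<in> B k (i k y)" using meets[of y k] by blast
      then show ?thesis unfolding B_def mem_ball by (auto simp only: dist_commute)
    qed
    then obtain x where "\<forall>k. x k \<in> orbit y \<and> dist (x k) (e (i k y)) < (1/2)^k"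
      using choice[of "\<lambda>k x. x \<in> orbit y \<and> dist x (e (i k y)) < (1/2)^k"] by blast
    then have x: "\<And>k. x k \<in> orbit y" "\<And>k. dist (x k) (e (i k y)) < (1/2)^k" by auto
    have "(\<lambda>k. dist (x k) (e (i k y))) \<longlonglongrightarrow> 0"
    proof (rule tendsto_sandwich[OF _ _ tendsto_const LIMSEQ_realpow_zero[of "1/2"]])
      show "\<forall>\<^sub>F k in sequentially. dist (x k) (e (i k y)) \<le> (1/2)^k"
        using x(2) by (intro always_eventually allI less_imp_le)
    qed auto
    moreover have "(\<lambda>k. dist (e (i k y)) (s y)) \<longlonglongrightarrow> 0"
      using s_lim[of y] by (subst (asm) tendsto_dist_iff)
    ultimately have "(\<lambda>k. dist (x k) (e (i k y)) + dist (e (i k y)) (s y)) \<longlonglongrightarrow> 0 + 0"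
      by (rule tendsto_add)
    then have sum0: "(\<lambda>k. dist (x k) (e (i k y)) + dist (e (i k y)) (s y)) \<longlonglongrightarrow> 0" by simp
    have "(\<lambda>k. dist (x k) (s y)) \<longlonglongrightarrow> 0"
    proof (rule tendsto_sandwich[OF _ _ tendsto_const sum0])
      show "\<forall>\<^sub>F k in sequentially. dist (x k) (s y) \<le> dist (x k) (e (i k y)) + dist (e (i k y)) (s y)"
        by (intro always_eventually allI dist_triangle)
    qed simp
    then have "x \<longlonglongrightarrow> s y" by (subst tendsto_dist_iff)
    then show ?thesis using closed_sequentially[OF closed_orbit] x(1) by blast
  qed
  moreover have "s \<in> borel_measurable borel"
  proof (rule borel_measurable_LIMSEQ_metric)
    show "(\<lambda>y. e (i k y)) \<in> borel_measurable borel" for k by measurable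
  qed (use s_lim in auto)
  moreover have "s (act g y) = s y" for g y unfolding s_def i_inv ..
  ultimately show ?thesis using that by blast
qed

text \<open>
  The group coordinate of \<open>y\<close> relative to the selected point of its orbit is unique because the action
  is free, and Borel because the inverse image of a closed set of group elements is the inverse image of
  a closed part of the orbit relation under the Borel map \<open>y \<mapsto> (y, s y)\<close>.
\<close>
lemma measurable_orbit_coordinates:
  obtains h s where "h \<in> borel_measurable borel" "s \<in> borel_measurable borel"
    "\<And>g y. s (act g y) = s y" "\<And>y. act (h y) (s y) = y"
proof -
  obtain s where s[measurable]: "s \<in> borel_measurable borel"
    and inv: "\<And>g y. s (act g y) = s y" and orb: "\<And>y. s y \<in> orbit y"
    by (rule measurable_orbit_selector) blast
  have "\<exists>g. act g (s y) = y" for y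
  proof -
    obtain g where "s y = act g y" using orb[of y] unfolding orbit_def by blast
    then have "act (- g) (s y) = y" by simp
    then show ?thesis ..
  qed
  then obtain h where h: "\<And>y. act (h y) (s y) = y" by metis
  have "h \<in> borel_measurable borel"
  proof (rule borel_measurableI)
    fix U :: "'g set" assume "open U"
    then have "closed (- U)" by (rule closed_Compl)
    let ?R = "(\<lambda>(g, y). (act g y, y)) ` ((- U) \<times> UNIV)"
    have R: "?R \<in> sets (borel \<Otimes>\<^sub>M borel)"
      unfolding borel_prod using closed_orbit_relation[OF \<open>closed (- U)\<close>] by (rule borel_closed)
    have p: "(\<lambda>y. (y, s y)) \<in> measurable borel (borel \<Otimes>\<^sub>M borel)" by measurable
    have "h -` U = - ((\<lambda>y. (y, s y)) -` ?R)"
    proof (intro set_eqI iffI)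
      fix y assume y: "y \<in> h -` U"
      show "y \<in> - ((\<lambda>y. (y, s y)) -` ?R)"
      proof
        assume "y \<in> (\<lambda>y. (y, s y)) -` ?R"
        then obtain g where "g \<notin> U" "y = act g (s y)" by auto
        then show False using y act_cancel[of g "s y" "h y"] h[of y] by auto
      qed
    next
      fix y assume "y \<in> - ((\<lambda>y. (y, s y)) -` ?R)"
      moreover have "(y, s y) = (\<lambda>(g, y). (act g y, y)) (h y, s y)" using h by simp
      ultimately show "y \<in> h -` U" by blast
    qed
    then show "h -` U \<inter> space borel \<in> sets borel"
      using measurable_sets[OF p R] by (simp add: borel_comp)
  qed
  then show ?thesis using that s inv h by blast
qed

end

section \<open>Mixtures over the group\<close>

definition borel_probs :: "'a::topological_space measure set" where
  "borel_probs = space (prob_algebra borel)"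

lemma borel_probsD:
  assumes "M \<in> borel_probs"
  shows "prob_space M" "sets M = sets borel" "space M = UNIV"
  using assms sets_eq_imp_space_eq[of M borel] by (auto simp: borel_probs_def space_prob_algebra)

lemma borel_probsI: "prob_space M \<Longrightarrow> sets M = sets borel \<Longrightarrow> M \<in> borel_probs"
  by (simp add: borel_probs_def space_prob_algebra)

lemma bind_pmf_borel_probs:
  fixes \<pi> :: "'i \<Rightarrow> 'a::topological_space measure"
  assumes \<pi>: "\<And>i. \<pi> i \<in> borel_probs"
  shows "measure_pmf w \<bind> \<pi> \<in> borel_probs"
    and "f \<in> borel_measurable borel \<Longrightarrow>
      (\<integral>\<^sup>+x. f x \<partial>(measure_pmf w \<bind> \<pi>)) = (\<integral>\<^sup>+i. \<integral>\<^sup>+x. f x \<partial>\<pi> i \<partial>w)"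
proof -
  have m: "\<pi> \<in> measurable (measure_pmf w) (subprob_algebra borel)"
    using borel_probsD[OF \<pi>] by (auto simp: space_subprob_algebra prob_space_imp_subprob_space)
  show "measure_pmf w \<bind> \<pi> \<in> borel_probs"
  proof (rule borel_probsI)
    show "prob_space (measure_pmf w \<bind> \<pi>)"
      using m borel_probsD(1)[OF \<pi>] by (intro measure_pmf.prob_space_bind[where S = borel]) auto
    show "sets (measure_pmf w \<bind> \<pi>) = sets borel"
      using borel_probsD(2)[OF \<pi>] by (subst sets_bind[where N = borel]) auto
  qed
  show "(\<integral>\<^sup>+x. f x \<partial>(measure_pmf w \<bind> \<pi>)) = (\<integral>\<^sup>+i. \<integral>\<^sup>+x. f x \<partial>\<pi> i \<partial>w)"
    if "f \<in> borel_measurable borel" using that m by (rule nn_integral_bind)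
qed

lemma absolutely_continuous_distr_density:
  assumes T[measurable]: "T \<in> measurable M N" and D[measurable]: "D \<in> borel_measurable M"
  shows "absolutely_continuous (distr M N T) (distr (density M D) N T)"
  unfolding absolutely_continuous_def
proof
  fix B assume "B \<in> null_sets (distr M N T)"
  then have B: "B \<in> sets N" and "emeasure M (T -` B \<inter> space M) = 0"
    by (auto simp: null_sets_def emeasure_distr)
  then have "T -` B \<inter> space M \<in> null_sets M" using T by (auto simp: null_sets_def)
  then have "T -` B \<inter> space M \<in> null_sets (density M D)"
    by (subst null_sets_density_iff) (auto intro: AE_I' dest: null_setsD2)
  then show "B \<in> null_sets (distr (density M D) N T)"
    using B by (auto simp: null_sets_def emeasure_distr)
qed

context free_proper_action
begin

definition mixture :: "'g measure \<Rightarrow> 'y measure \<Rightarrow> 'y measure" where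
  "mixture \<pi> P = distr (\<pi> \<Otimes>\<^sub>M P) borel (\<lambda>(g, y). act g y)"

lemma pair_sets: "\<pi> \<in> borel_probs \<Longrightarrow> P \<in> borel_probs \<Longrightarrow>
    sets (\<pi> \<Otimes>\<^sub>M P) = sets (borel \<Otimes>\<^sub>M borel)"
  by (rule sets_pair_measure_cong[OF borel_probsD(2) borel_probsD(2)])

lemma act_measurable_prod: "\<pi> \<in> borel_probs \<Longrightarrow> P \<in> borel_probs \<Longrightarrow>
    (\<lambda>(g, y). act g y) \<in> measurable (\<pi> \<Otimes>\<^sub>M P) borel"
  using act_measurable_pair measurable_cong_sets[OF pair_sets refl] by blast

lemma mixture_borel_probs:
  assumes "\<pi> \<in> borel_probs" "P \<in> borel_probs"
  shows "mixture \<pi> P \<in> borel_probs"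
proof (rule borel_probsI)
  have "prob_space (\<pi> \<Otimes>\<^sub>M P)"
    using borel_probsD(1)[OF assms(1)] borel_probsD(1)[OF assms(2)] by (rule prob_space_pair)
  then show "prob_space (mixture \<pi> P)"
    unfolding mixture_def by (rule prob_space.prob_space_distr) (rule act_measurable_prod[OF assms])
qed (simp add: mixture_def)

lemma nn_integral_mixture:
  assumes \<pi>: "\<pi> \<in> borel_probs" and P: "P \<in> borel_probs" and f[measurable]: "f \<in> borel_measurable borel"
  shows "(\<integral>\<^sup>+y. f y \<partial>mixture \<pi> P) = (\<integral>\<^sup>+g. \<integral>\<^sup>+y. f (act g y) \<partial>P \<partial>\<pi>)"
proof -
  interpret base: prob_space P by (rule borel_probsD[OF P])
  note m = act_measurable_prod[OF \<pi> P]
  have fm: "(\<lambda>z. f (case z of (g, y) \<Rightarrow> act g y)) \<in> borel_measurable (\<pi> \<Otimes>\<^sub>M P)"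
    by (rule measurable_compose[OF m f])
  have e: "(\<integral>\<^sup>+y. f y \<partial>mixture \<pi> P) = (\<integral>\<^sup>+z. f (case z of (g, y) \<Rightarrow> act g y) \<partial>(\<pi> \<Otimes>\<^sub>M P))"
    unfolding mixture_def using f by (intro nn_integral_distr m) simp
  show "(\<integral>\<^sup>+y. f y \<partial>mixture \<pi> P) = (\<integral>\<^sup>+g. \<integral>\<^sup>+y. f (act g y) \<partial>P \<partial>\<pi>)"
    unfolding e using base.nn_integral_fst[OF fm] by simp
qed

lemma emeasure_mixture:
  assumes \<pi>: "\<pi> \<in> borel_probs" and P: "P \<in> borel_probs" and B[measurable]: "B \<in> sets borel"
  shows "emeasure (mixture \<pi> P) B = (\<integral>\<^sup>+g. emeasure P (act g -` B) \<partial>\<pi>)"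
proof -
  note sets = borel_probsD(2)[OF P] and m = borel_probsD(2)[OF mixture_borel_probs[OF \<pi> P]]
  have "emeasure (mixture \<pi> P) B = (\<integral>\<^sup>+y. indicator B y \<partial>mixture \<pi> P)"
    using B m by simp
  also have "\<dots> = (\<integral>\<^sup>+g. \<integral>\<^sup>+y. indicator B (act g y) \<partial>P \<partial>\<pi>)"
    using B by (intro nn_integral_mixture[OF \<pi> P]) auto
  also have "\<dots> = (\<integral>\<^sup>+g. emeasure P (act g -` B) \<partial>\<pi>)"
  proof (rule nn_integral_cong)
    fix g
    have "act g -` B \<in> sets P" using measurable_sets[OF act_measurable B, of g] sets by simp
    then have "emeasure P (act g -` B) = (\<integral>\<^sup>+y. indicator (act g -` B) y \<partial>P)" by simp
    then show "(\<integral>\<^sup>+y. indicator B (act g y) \<partial>P) = emeasure P (act g -` B)"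
      by (simp add: indicator_def)
  qed
  finally show ?thesis .
qed

text \<open>Mixtures are affine in the prior. With a Bernoulli law this makes the set of mixtures convex,
  with a geometric law it yields a mixture that dominates those for a whole sequence of priors.\<close>
lemma mixture_bind_pmf:
  assumes \<pi>: "\<And>i. \<pi> i \<in> borel_probs" and P: "P \<in> borel_probs" and B: "B \<in> sets borel"
  shows "emeasure (mixture (measure_pmf w \<bind> \<pi>) P) B = (\<integral>\<^sup>+i. emeasure (mixture (\<pi> i) P) B \<partial>w)"
proof -
  interpret P: prob_space P by (rule borel_probsD[OF P])
  have "act g -` B = Pair g -` ((\<lambda>(g, y). act g y) -` B)" for g by (simp add: vimage_def)
  moreover have "(\<lambda>(g, y). act g y) -` B \<in> sets (borel \<Otimes>\<^sub>M P)"
    using measurable_sets[OF act_measurable_pair B] sets_pair_measure_cong[OF refl borel_probsD(2)[OF P], of "borel :: 'g measure"]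
    by (simp add: space_pair_measure)
  ultimately have "(\<lambda>g. emeasure P (act g -` B)) \<in> borel_measurable borel"
    using P.measurable_emeasure_Pair by simp
  then show ?thesis
    by (simp add: emeasure_mixture bind_pmf_borel_probs \<pi> P B)
qed

lemma bind_eq_mixture:
  assumes \<pi>: "\<pi> \<in> borel_probs" and P: "\<And>g. P g \<in> borel_probs" and inv: "invariant_model act P"
  shows "\<pi> \<bind> P = mixture \<pi> (P 0)"
proof (rule measure_eqI)
  have s: "sets (\<pi> \<bind> P) = sets borel"
    using borel_probsD[OF P] borel_probsD[OF \<pi>] by (intro sets_bind) auto
  show "sets (\<pi> \<bind> P) = sets (mixture \<pi> (P 0))"
    using s borel_probsD(2)[OF mixture_borel_probs[OF \<pi> P]] by simp
  fix B assume "B \<in> sets (\<pi> \<bind> P)"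
  then have B: "B \<in> sets borel" using s by simp
  have "emeasure (P g) B = emeasure (P 0) (act g -` B)" for g
  proof -
    interpret Pg: prob_space "P g" by (rule borel_probsD[OF P])
    interpret P0: prob_space "P 0" by (rule borel_probsD[OF P])
    have pre: "act g -` B \<in> sets borel" using measurable_sets[OF act_measurable B, of g] by simp
    have "act g ` (act g -` B) = B"
    proof (intro set_eqI iffI)
      fix x assume "x \<in> B"
      then have "act (- g) x \<in> act g -` B" by simp
      then show "x \<in> act g ` (act g -` B)" by (metis act_inverse(1) imageI)
    qed auto
    moreover have "measure (P (g + 0)) (act g ` (act g -` B)) = measure (P 0) (act g -` B)"
      using inv[unfolded invariant_model_def, rule_format, OF pre] .
    ultimately show ?thesis by (simp add: Pg.emeasure_eq_measure P0.emeasure_eq_measure)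
  qed
  then show "emeasure (\<pi> \<bind> P) B = emeasure (mixture \<pi> (P 0)) B"
    using invariant_model_measurable(2)[OF action cont _ inv] \<pi> P B
    by (simp add: emeasure_mixture borel_probs_def)
qed

text \<open>The chain rule behind the upper bound: an invariant density is not changed by the random group
  element.\<close>
lemma mixture_invariant_density:
  assumes \<pi>: "\<pi> \<in> borel_probs" and P: "P \<in> borel_probs" "density P F \<in> borel_probs"
    and F[measurable]: "F \<in> borel_measurable borel" and inv: "\<And>g y. F (act g y) = F y"
  shows "mixture \<pi> (density P F) = density (mixture \<pi> P) F"
proof (rule measure_eqI)
  note s = borel_probsD(2)[OF mixture_borel_probs[OF \<pi> P(1)]]
    borel_probsD(2)[OF mixture_borel_probs[OF \<pi> P(2)]] borel_probsD(2)[OF P(1)]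
  have F': "F \<in> borel_measurable (mixture \<pi> P)" "F \<in> borel_measurable P"
    using F unfolding measurable_def s by (auto simp: s[THEN sets_eq_imp_space_eq])
  show "sets (mixture \<pi> (density P F)) = sets (density (mixture \<pi> P) F)" using s by simp
  fix B assume "B \<in> sets (mixture \<pi> (density P F))"
  then have B[measurable]: "B \<in> sets borel" using s by simp
  have "emeasure (density (mixture \<pi> P) F) B = (\<integral>\<^sup>+y. F y * indicator B y \<partial>mixture \<pi> P)"
    using s F' B by (intro emeasure_density) auto
  also have "\<dots> = (\<integral>\<^sup>+g. \<integral>\<^sup>+y. F y * indicator B (act g y) \<partial>P \<partial>\<pi>)"
    using nn_integral_mixture[OF \<pi> P(1), of "\<lambda>y. F y * indicator B y"] by (simp add: inv)
  also have "\<dots> = (\<integral>\<^sup>+g. emeasure (density P F) (act g -` B) \<partial>\<pi>)"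
  proof (rule nn_integral_cong)
    fix g
    have "act g -` B \<in> sets P" using measurable_sets[OF act_measurable B, of g] s by simp
    then have "emeasure (density P F) (act g -` B) = (\<integral>\<^sup>+y. F y * indicator (act g -` B) y \<partial>P)"
      using F' by (intro emeasure_density) auto
    then show "(\<integral>\<^sup>+y. F y * indicator B (act g y) \<partial>P) = emeasure (density P F) (act g -` B)"
      by (simp add: indicator_def)
  qed
  finally show "emeasure (mixture \<pi> (density P F)) B = emeasure (density (mixture \<pi> P) F) B"
    using emeasure_mixture[OF \<pi> P(2) B] by simp
qed

lemma distr_mixture_invariant:
  assumes \<pi>: "\<pi> \<in> borel_probs" and P: "P \<in> borel_probs"
    and m[measurable]: "m \<in> measurable borel N" and inv: "\<And>g y. m (act g y) = m y"
  shows "distr (mixture \<pi> P) N m = distr P N m"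
proof (rule measure_eqI)
  interpret \<pi>: prob_space \<pi> by (rule borel_probsD[OF \<pi>])
  note s = borel_probsD[OF mixture_borel_probs[OF \<pi> P]] borel_probsD[OF P]
  have m': "m \<in> measurable (mixture \<pi> P) N" "m \<in> measurable P N"
    using m unfolding measurable_def s by auto
  fix A assume "A \<in> sets (distr (mixture \<pi> P) N m)"
  then have A: "A \<in> sets N" by simp
  have B: "m -` A \<in> sets borel" using measurable_sets[OF m A] by simp
  have "emeasure (distr (mixture \<pi> P) N m) A = emeasure (mixture \<pi> P) (m -` A)"
    using emeasure_distr[OF m'(1) A] s(3) by simp
  also have "\<dots> = (\<integral>\<^sup>+g. emeasure P (act g -` (m -` A)) \<partial>\<pi>)" by (rule emeasure_mixture[OF \<pi> P B])
  also have "\<dots> = (\<integral>\<^sup>+g. emeasure P (m -` A) \<partial>\<pi>)" by (simp add: vimage_def inv)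
  also have "\<dots> = emeasure P (m -` A)" by (simp add: \<pi>.emeasure_space_1)
  also have "\<dots> = emeasure (distr P N m) A" using emeasure_distr[OF m'(2) A] s(6) by simp
  finally show "emeasure (distr (mixture \<pi> P) N m) A = emeasure (distr P N m) A" .
qed simp

section \<open>Mixtures of measures that agree on invariant events\<close>

lemma pair_measure_density_snd:
  fixes D :: "'y \<Rightarrow> real"
  assumes P: "P \<in> borel_probs" and Q: "density P (\<lambda>y. ennreal (D y)) \<in> borel_probs"
    and D: "D \<in> borel_measurable borel"
  shows "\<pi> \<Otimes>\<^sub>M density P (\<lambda>y. ennreal (D y)) = density (\<pi> \<Otimes>\<^sub>M P) (\<lambda>(g, y). ennreal (D y))"
proof -
  have DP: "D \<in> borel_measurable P" using D measurable_cong_sets[OF borel_probsD(2)[OF P] refl] by blast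
  have "\<pi> \<Otimes>\<^sub>M density P (\<lambda>y. ennreal (D y))
      = density \<pi> (\<lambda>_. 1) \<Otimes>\<^sub>M density P (\<lambda>y. ennreal (D y))" by (simp add: density_1)
  also have "\<dots> = density (\<pi> \<Otimes>\<^sub>M P) (\<lambda>(g, y). 1 * ennreal (D y))"
    using DP prob_space_imp_sigma_finite[OF borel_probsD(1)[OF P]]
      prob_space_imp_sigma_finite[OF borel_probsD(1)[OF Q]]
    by (intro pair_measure_density) auto
  finally show ?thesis by simp
qed

lemma mixture_absolutely_continuous:
  fixes D :: "'y \<Rightarrow> real"
  assumes \<pi>: "\<pi> \<in> borel_probs" and P: "P \<in> borel_probs"
    and Q: "density P (\<lambda>y. ennreal (D y)) \<in> borel_probs" and D: "D \<in> borel_measurable borel"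
  shows "absolutely_continuous (mixture \<pi> P) (mixture \<pi> (density P (\<lambda>y. ennreal (D y))))"
proof -
  have DP: "D \<in> borel_measurable P" using D measurable_cong_sets[OF borel_probsD(2)[OF P] refl] by blast
  have "(\<lambda>(g, y). ennreal (D y)) \<in> borel_measurable (\<pi> \<Otimes>\<^sub>M P)"
    using DP by measurable
  then show ?thesis
    unfolding mixture_def pair_measure_density_snd[OF P Q D] by (rule absolutely_continuous_distr_density[OF act_measurable_prod[OF \<pi> P]])
qed

lemma measure_mixture_bernoulli:
  assumes "\<pi> \<in> borel_probs" "\<pi>' \<in> borel_probs" "0 \<le> t" "t \<le> 1"
  obtains \<kappa> where "\<kappa> \<in> borel_probs" "\<And>P B. P \<in> borel_probs \<Longrightarrow> B \<in> sets borel \<Longrightarrow>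
    measure (mixture \<kappa> P) B = (1 - t) * measure (mixture \<pi> P) B + t * measure (mixture \<pi>' P) B"
proof
  let ?f = "\<lambda>b. if b then \<pi>' else \<pi>"
  let ?\<kappa> = "measure_pmf (bernoulli_pmf t) \<bind> ?f"
  have f: "?f b \<in> borel_probs" for b using assms by simp
  show \<kappa>: "?\<kappa> \<in> borel_probs" by (rule bind_pmf_borel_probs(1)) (rule f)
  fix P :: "'y measure" and B :: "'y set" assume P: "P \<in> borel_probs" and B: "B \<in> sets borel"
  have fin: "finite_measure (mixture \<sigma> P)" if "\<sigma> \<in> borel_probs" for \<sigma>
    using borel_probsD(1)[OF mixture_borel_probs[OF that P]] by (simp add: prob_space_def)
  have "emeasure (mixture ?\<kappa> P) B
      = emeasure (mixture \<pi>' P) B * ennreal t + emeasure (mixture \<pi> P) B * ennreal (1 - t)"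
    using mixture_bind_pmf[OF f P B, of "bernoulli_pmf t"] assms by simp
  then have "ennreal (measure (mixture ?\<kappa> P) B)
      = ennreal (measure (mixture \<pi>' P) B * t + measure (mixture \<pi> P) B * (1 - t))"
    using assms fin[OF \<kappa>] fin[OF assms(1)] fin[OF assms(2)]
    by (simp add: finite_measure.emeasure_eq_measure ennreal_mult ennreal_plus)
  then show "measure (mixture ?\<kappa> P) B
      = (1 - t) * measure (mixture \<pi> P) B + t * measure (mixture \<pi>' P) B"
    using assms by (subst (asm) ennreal_inj) (auto simp: mult.commute)
qed

definition agree_on_invariant_events :: "'y measure \<Rightarrow> 'y measure \<Rightarrow> bool" where
  "agree_on_invariant_events P Q \<longleftrightarrow>
     (\<forall>B\<in>sets borel. (\<forall>g. act g ` B = B) \<longrightarrow> emeasure P B = emeasure Q B)"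

text \<open>
  In the coordinates \<open>y = h(y) s(y)\<close>, the mean of \<open>\<phi>(g y)\<close> over the prior is the mean of a function of
  the group translated by \<open>h(y)\<close>, hence asymptotically the mean of \<open>\<phi>(g s(y))\<close>. The latter depends on
  \<open>y\<close> only through the invariant map \<open>s\<close>, whose law is the same for both measures.
\<close>
lemma mixtures_merge:
  fixes \<pi> :: "nat \<Rightarrow> 'g measure"
  assumes \<pi>: "\<And>k. \<pi> k \<in> borel_probs"
    and inv: "\<And>B g. B \<in> sets borel \<Longrightarrow>
      (\<lambda>k. \<bar>measure (\<pi> k) B - measure (\<pi> k) ((\<lambda>b. b + g) ` B)\<bar>) \<longlonglongrightarrow> 0"
    and P: "P \<in> borel_probs" and Q: "Q \<in> borel_probs"
    and agree: "agree_on_invariant_events P Q"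
    and \<phi>[measurable]: "\<phi> \<in> borel_measurable borel" and b: "\<And>y. 0 \<le> \<phi> y" "\<And>y. \<phi> y \<le> (1::real)"
  shows "(\<lambda>k. (\<integral>y. \<phi> y \<partial>mixture (\<pi> k) Q) - (\<integral>y. \<phi> y \<partial>mixture (\<pi> k) P)) \<longlonglongrightarrow> 0"
proof -
  obtain h s where h: "h \<in> borel_measurable borel" and s[measurable]: "s \<in> borel_measurable borel"
    and s_inv: "\<And>g y. s (act g y) = s y" and hs: "\<And>y. act (h y) (s y) = y"
    by (rule measurable_orbit_coordinates) blast
  define A where "A k y = (\<integral>g. \<phi> (act g y) \<partial>\<pi> k)" for k y
  note \<pi>D = borel_probsD[OF \<pi>]
  have \<phi>_pair: "(\<lambda>(g, y). \<phi> (act g y)) \<in> borel_measurable (borel \<Otimes>\<^sub>M borel)"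
    using measurable_compose[OF act_measurable_pair \<phi>] by (simp add: case_prod_unfold)
  have int_\<pi>: "integrable (\<pi> k) (\<lambda>g. \<phi> (act g y))" for k y
  proof -
    interpret prob_space "\<pi> k" by (rule \<pi>D)
    have "(\<lambda>g. \<phi> (act g y)) \<in> borel_measurable borel"
      by (rule measurable_compose[OF act_measurable_left \<phi>])
    then have "(\<lambda>g. \<phi> (act g y)) \<in> borel_measurable (\<pi> k)"
      using measurable_cong_sets[OF \<pi>D(2) refl] by blast
    then show ?thesis using b by (intro integrable_const_bound[where B = 1]) auto
  qed
  have A01: "0 \<le> A k y" "A k y \<le> 1" for k y
  proof -
    interpret prob_space "\<pi> k" by (rule \<pi>D)
    show "0 \<le> A k y" unfolding A_def using b by (intro integral_nonneg_AE) auto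
    have "A k y \<le> (\<integral>g. 1 \<partial>\<pi> k)" unfolding A_def using b int_\<pi> by (intro integral_mono) auto
    then show "A k y \<le> 1" by (simp add: prob_space)
  qed
  have A_meas: "A k \<in> borel_measurable borel" for k
  proof -
    interpret prob_space "\<pi> k" by (rule \<pi>D)
    have "(\<lambda>(y, g). \<phi> (act g y)) \<in> borel_measurable (borel \<Otimes>\<^sub>M borel)"
      using measurable_compose[OF measurable_pair_swap' \<phi>_pair] by (simp add: case_prod_unfold)
    then have "(\<lambda>(y, g). \<phi> (act g y)) \<in> borel_measurable (borel \<Otimes>\<^sub>M \<pi> k)"
      using measurable_cong_sets[OF sets_pair_measure_cong[OF refl \<pi>D(2)] refl] by blast
    then show ?thesis unfolding A_def[abs_def] by (rule borel_measurable_lebesgue_integral)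
  qed
  have int_mix: "(\<integral>y. \<phi> y \<partial>mixture (\<pi> k) R) = (\<integral>y. A k y \<partial>R)" if R: "R \<in> borel_probs" for k R
  proof -
    interpret prior: prob_space "\<pi> k" by (rule \<pi>D)
    interpret base: prob_space R by (rule borel_probsD[OF R])
    interpret pair_prob_space "\<pi> k" R ..
    have m: "(\<lambda>(g, y). \<phi> (act g y)) \<in> borel_measurable (\<pi> k \<Otimes>\<^sub>M R)"
      using \<phi>_pair measurable_cong_sets[OF pair_sets[OF \<pi> R] refl] by blast
    then have i: "integrable (\<pi> k \<Otimes>\<^sub>M R) (\<lambda>(g, y). \<phi> (act g y))"
      using b by (intro P.integrable_const_bound[where B = 1]) auto
    have "(\<integral>y. \<phi> y \<partial>mixture (\<pi> k) R) = (\<integral>z. \<phi> (case z of (g, y) \<Rightarrow> act g y) \<partial>(\<pi> k \<Otimes>\<^sub>M R))"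
      unfolding mixture_def using \<phi> by (intro integral_distr act_measurable_prod \<pi> R)
    also have "\<dots> = (\<integral>z. (case z of (g, y) \<Rightarrow> \<phi> (act g y)) \<partial>(\<pi> k \<Otimes>\<^sub>M R))"
      by (simp add: case_prod_unfold)
    also have "\<dots> = (\<integral>y. A k y \<partial>R)" unfolding A_def using integral_snd[OF i] by simp
    finally show ?thesis .
  qed
  have lim: "(\<lambda>k. (\<integral>y. A k y \<partial>R) - (\<integral>y. A k (s y) \<partial>R)) \<longlonglongrightarrow> 0" if R: "R \<in> borel_probs" for R
  proof -
    interpret R: prob_space R by (rule borel_probsD[OF R])
    have Rm: "f \<in> borel_measurable R" if "f \<in> borel_measurable borel" for f :: "'y \<Rightarrow> real"
      using that measurable_cong_sets[OF borel_probsD(2)[OF R] refl] by blast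
    have As: "(\<lambda>y. A k (s y)) \<in> borel_measurable borel" for k by (rule measurable_compose[OF s A_meas])
    have i: "integrable R (A k)" "integrable R (\<lambda>y. A k (s y))" for k
      using A01 Rm[OF A_meas] Rm[OF As] by (auto intro!: R.integrable_const_bound[where B = 1])
    have ptw: "(\<lambda>k. A k y - A k (s y)) \<longlonglongrightarrow> 0" for y
    proof -
      have "\<phi> (act g y) = \<phi> (act (g + h y) (s y))" for g by (simp add: act_add hs)
      then have "A k y - A k (s y) = (\<integral>g. \<phi> (act (g + h y) (s y)) \<partial>\<pi> k) - (\<integral>g. \<phi> (act g (s y)) \<partial>\<pi> k)"
        for k unfolding A_def by simp
      moreover have "(\<lambda>k. (\<integral>g. \<phi> (act (g + h y) (s y)) \<partial>\<pi> k) - (\<integral>g. \<phi> (act g (s y)) \<partial>\<pi> k)) \<longlonglongrightarrow> 0"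
        using \<pi> inv b
        by (intro asymptotic_invariance_integral[where \<psi> = "\<lambda>g. \<phi> (act g (s y))"]
            measurable_compose[OF act_measurable_left \<phi>]) (auto simp: borel_probs_def)
      ultimately show ?thesis by simp
    qed
    have "(\<lambda>k. \<integral>y. A k y - A k (s y) \<partial>R) \<longlonglongrightarrow> (\<integral>y. 0 \<partial>R)"
    proof (rule integral_dominated_convergence[where w = "\<lambda>_. 1"])
      show "AE y in R. norm (A k y - A k (s y)) \<le> 1" for k
      proof (rule AE_I2)
        fix y show "norm (A k y - A k (s y)) \<le> 1"
          using A01[of k y] A01[of k "s y"] by (simp add: abs_le_iff)
      qed
    qed (use ptw i in auto)
    then show ?thesis using i by simp
  qed
  have "distr P borel s = distr Q borel s"
  proof (rule measure_eqI)
    fix B assume "B \<in> sets (distr P borel s)"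
    then have B: "B \<in> sets borel" by simp
    have pre: "s -` B \<in> sets borel" using measurable_sets[OF s B] by simp
    have "act g ` (s -` B) = s -` B" for g
    proof (intro set_eqI iffI)
      fix y assume "y \<in> s -` B"
      then have "act (- g) y \<in> s -` B" by (simp add: s_inv)
      then show "y \<in> act g ` (s -` B)" by (metis act_inverse(1) imageI)
    qed (auto simp: s_inv)
    then have "emeasure P (s -` B) = emeasure Q (s -` B)"
      using agree pre unfolding agree_on_invariant_events_def by blast
    moreover have "emeasure (distr R borel s) B = emeasure R (s -` B)" if R: "R \<in> borel_probs" for R
    proof -
      have "s \<in> measurable R borel" using s measurable_cong_sets[OF borel_probsD(2)[OF R] refl] by blast
      then show ?thesis using B borel_probsD(3)[OF R] by (simp add: emeasure_distr)
    qed
    ultimately show "emeasure (distr P borel s) B = emeasure (distr Q borel s) B" using P Q by simp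
  qed simp
  moreover have "(\<integral>y. A k (s y) \<partial>R) = (\<integral>y. A k y \<partial>distr R borel s)" if R: "R \<in> borel_probs" for k R
  proof -
    have "s \<in> measurable R borel" using s measurable_cong_sets[OF borel_probsD(2)[OF R] refl] by blast
    then show ?thesis using A_meas by (intro integral_distr[symmetric])
  qed
  ultimately have eq: "(\<integral>y. A k (s y) \<partial>Q) = (\<integral>y. A k (s y) \<partial>P)" for k using P Q by simp
  have "(\<lambda>k. ((\<integral>y. A k y \<partial>Q) - (\<integral>y. A k (s y) \<partial>Q)) - ((\<integral>y. A k y \<partial>P) - (\<integral>y. A k (s y) \<partial>P))) \<longlonglongrightarrow> 0 - 0"
    by (intro tendsto_diff lim P Q)
  then show ?thesis unfolding int_mix[OF P] int_mix[OF Q] eq by simp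
qed

text \<open>
  From weak to strong convergence by convexity, as in Mazur's lemma. The differences of the two
  mixtures that have a density with respect to the dominating measure \<open>\<rho>\<close> form a convex set of
  \<open>L\<^sup>1(\<rho>)\<close> that contains those for the given priors; the means of a bounded function that separates
  this set from \<open>0\<close> could not merge.
\<close>
lemma close_mixture_exists:
  fixes D :: "'y \<Rightarrow> real" and \<pi> :: "nat \<Rightarrow> 'g measure"
  assumes \<pi>: "\<And>k. \<pi> k \<in> borel_probs"
    and P: "P \<in> borel_probs" and Q: "Q \<in> borel_probs" "Q = density P (\<lambda>y. ennreal (D y))"
    and D: "D \<in> borel_measurable borel"
    and merge: "\<And>\<phi> :: 'y \<Rightarrow> real. \<phi> \<in> borel_measurable borel \<Longrightarrow> (\<And>y. 0 \<le> \<phi> y) \<Longrightarrow> (\<And>y. \<phi> y \<le> 1) \<Longrightarrow>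
      (\<lambda>k. (\<integral>y. \<phi> y \<partial>mixture (\<pi> k) Q) - (\<integral>y. \<phi> y \<partial>mixture (\<pi> k) P)) \<longlonglongrightarrow> 0"
    and c: "0 < c"
  obtains \<kappa> where "\<kappa> \<in> borel_probs"
    "\<And>A. A \<in> sets borel \<Longrightarrow> \<bar>measure (mixture \<kappa> Q) A - measure (mixture \<kappa> P) A\<bar> \<le> c"
proof -
  define \<rho> where "\<rho> = mixture (measure_pmf (geometric_pmf (1/2)) \<bind> \<pi>) P"
  have \<rho>: "\<rho> \<in> borel_probs" unfolding \<rho>_def by (intro mixture_borel_probs bind_pmf_borel_probs(1) \<pi> P)
  interpret \<rho>: prob_space \<rho> by (rule borel_probsD[OF \<rho>])
  note \<rho>s = borel_probsD(2)[OF \<rho>]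
  define represents where "represents w \<kappa> \<longleftrightarrow> \<kappa> \<in> borel_probs \<and> integrable \<rho> w \<and>
    (\<forall>A\<in>sets borel. (\<integral>y. indicator A y * w y \<partial>\<rho>) = measure (mixture \<kappa> Q) A - measure (mixture \<kappa> P) A)"
    for w :: "'y \<Rightarrow> real" and \<kappa>
  have representsD: "(\<integral>y. indicator A y * w y \<partial>\<rho>) = measure (mixture \<kappa> Q) A - measure (mixture \<kappa> P) A"
    if "represents w \<kappa>" "A \<in> sets borel" for w \<kappa> A
    using that by (simp add: represents_def)
  define W where "W = {w. \<exists>\<kappa>. represents w \<kappa>}"
  have int_ind: "integrable \<rho> (\<lambda>y. indicator A y * w y)" if "integrable \<rho> w" "A \<in> sets borel" for w :: "'y \<Rightarrow> real" and A
    using integrable_mult_indicator[of A \<rho> w] that \<rho>s by simp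
  have convex: "(\<lambda>y. (1 - t) * u y + t * v y) \<in> W"
    if uv: "u \<in> W" "v \<in> W" and t: "0 \<le> t" "t \<le> 1" for u v t
  proof -
    obtain \<kappa> \<kappa>' where r: "represents u \<kappa>" "represents v \<kappa>'" using uv unfolding W_def by blast
    then have k: "\<kappa> \<in> borel_probs" "\<kappa>' \<in> borel_probs" unfolding represents_def by auto
    obtain \<sigma> where \<sigma>: "\<sigma> \<in> borel_probs" "\<And>P B. P \<in> borel_probs \<Longrightarrow> B \<in> sets borel \<Longrightarrow>
        measure (mixture \<sigma> P) B = (1 - t) * measure (mixture \<kappa> P) B + t * measure (mixture \<kappa>' P) B"
      using measure_mixture_bernoulli[OF k t] by blast
    have "(\<integral>y. indicator A y * ((1 - t) * u y + t * v y) \<partial>\<rho>)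
        = measure (mixture \<sigma> Q) A - measure (mixture \<sigma> P) A" if A: "A \<in> sets borel" for A
    proof -
      have i: "integrable \<rho> (\<lambda>y. indicator A y * u y)" "integrable \<rho> (\<lambda>y. indicator A y * v y)"
        using r A int_ind unfolding represents_def by auto
      have "(\<integral>y. indicator A y * ((1 - t) * u y + t * v y) \<partial>\<rho>)
          = (\<integral>y. (1 - t) * (indicator A y * u y) + t * (indicator A y * v y) \<partial>\<rho>)"
        by (simp add: algebra_simps)
      also have "\<dots> = (1 - t) * (\<integral>y. indicator A y * u y \<partial>\<rho>) + t * (\<integral>y. indicator A y * v y \<partial>\<rho>)"
        using i by simp
      also have "(\<integral>y. indicator A y * u y \<partial>\<rho>) = measure (mixture \<kappa> Q) A - measure (mixture \<kappa> P) A"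
        by (rule representsD[OF r(1) A])
      also have "(\<integral>y. indicator A y * v y \<partial>\<rho>) = measure (mixture \<kappa>' Q) A - measure (mixture \<kappa>' P) A"
        by (rule representsD[OF r(2) A])
      also have "(1 - t) * (measure (mixture \<kappa> Q) A - measure (mixture \<kappa> P) A)
          + t * (measure (mixture \<kappa>' Q) A - measure (mixture \<kappa>' P) A)
          = measure (mixture \<sigma> Q) A - measure (mixture \<sigma> P) A"
        by (simp add: \<sigma>(2) P Q(1) A algebra_simps)
      finally show ?thesis .
    qed
    moreover have "integrable \<rho> (\<lambda>y. (1 - t) * u y + t * v y)"
      using r unfolding represents_def by auto
    ultimately have "represents (\<lambda>y. (1 - t) * u y + t * v y) \<sigma>"
      unfolding represents_def using \<sigma>(1) by blast
    then show ?thesis unfolding W_def by blast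
  qed
  have ex: "\<exists>w. represents w (\<pi> k) \<and> (\<forall>\<phi> :: 'y \<Rightarrow> real. \<phi> \<in> borel_measurable borel \<longrightarrow> (\<forall>y. 0 \<le> \<phi> y \<and> \<phi> y \<le> 1) \<longrightarrow>
      (\<integral>y. \<phi> y * w y \<partial>\<rho>) = (\<integral>y. \<phi> y \<partial>mixture (\<pi> k) Q) - (\<integral>y. \<phi> y \<partial>mixture (\<pi> k) P))" for k
  proof -
    have acP: "absolutely_continuous \<rho> (mixture (\<pi> k) P)"
      unfolding absolutely_continuous_def
    proof
      fix B assume B: "B \<in> null_sets \<rho>"
      then have Bs: "B \<in> sets borel" using \<rho>s by auto
      have "(\<integral>\<^sup>+i. emeasure (mixture (\<pi> i) P) B \<partial>geometric_pmf (1/2)) = 0"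
        using null_setsD1[OF B] mixture_bind_pmf[of \<pi>, OF \<pi> P Bs, of "geometric_pmf (1/2)"] unfolding \<rho>_def by simp
      then have "AE i in geometric_pmf (1/2). emeasure (mixture (\<pi> i) P) B = 0"
        by (subst (asm) nn_integral_0_iff_AE) auto
      then have "emeasure (mixture (\<pi> k) P) B = 0"
        by (simp add: AE_measure_pmf_iff set_pmf_geometric)
      then show "B \<in> null_sets (mixture (\<pi> k) P)"
        using Bs borel_probsD(2)[OF mixture_borel_probs[OF \<pi> P]] by (intro null_setsI) auto
    qed
    moreover have "absolutely_continuous (mixture (\<pi> k) P) (mixture (\<pi> k) Q)"
      using mixture_absolutely_continuous[OF \<pi> P _ D] Q by simp
    ultimately have acQ: "absolutely_continuous \<rho> (mixture (\<pi> k) Q)"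
      unfolding absolutely_continuous_def by blast
    note mP = borel_probsD[OF mixture_borel_probs[OF \<pi>[of k] P]]
      and mQ = borel_probsD[OF mixture_borel_probs[OF \<pi>[of k] Q(1)]]
    obtain f where f[measurable]: "f \<in> borel_measurable \<rho>" and f0: "\<And>y. 0 \<le> f y"
      and fd: "mixture (\<pi> k) Q = density \<rho> (\<lambda>y. ennreal (f y))"
      using real_density_exists[OF \<rho>.prob_space_axioms mQ(1) acQ] mQ(2) \<rho>s by metis
    obtain g where g[measurable]: "g \<in> borel_measurable \<rho>" and g0: "\<And>y. 0 \<le> g y"
      and gd: "mixture (\<pi> k) P = density \<rho> (\<lambda>y. ennreal (g y))"
      using real_density_exists[OF \<rho>.prob_space_axioms mP(1) acP] mP(2) \<rho>s by metis
    have fi: "integrable \<rho> f" using mQ(1) f0 unfolding fd by (intro integrable_prob_density) auto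
    have gi: "integrable \<rho> g" using mP(1) g0 unfolding gd by (intro integrable_prob_density) auto
    have "represents (\<lambda>y. f y - g y) (\<pi> k)"
      unfolding represents_def
    proof (intro conjI ballI)
      fix A :: "'y set" assume A: "A \<in> sets borel"
      then have A': "A \<in> sets \<rho>" using \<rho>s by simp
      show "(\<integral>y. indicator A y * (f y - g y) \<partial>\<rho>) = measure (mixture (\<pi> k) Q) A - measure (mixture (\<pi> k) P) A"
        unfolding fd gd measure_eq_integral_density[OF f f0 A'] measure_eq_integral_density[OF g g0 A']
        using int_ind[OF fi A] int_ind[OF gi A] by (simp add: right_diff_distrib)
    qed (use \<pi> fi gi in auto)
    moreover have "(\<integral>y. \<phi> y * (f y - g y) \<partial>\<rho>) = (\<integral>y. \<phi> y \<partial>mixture (\<pi> k) Q) - (\<integral>y. \<phi> y \<partial>mixture (\<pi> k) P)"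
      if \<phi>: "\<phi> \<in> borel_measurable borel" "\<forall>y. 0 \<le> \<phi> y \<and> \<phi> y \<le> 1" for \<phi> :: "'y \<Rightarrow> real"
    proof -
      have [measurable]: "\<phi> \<in> borel_measurable \<rho>" using \<phi>(1) measurable_cong_sets[OF \<rho>s refl] by blast
      have i: "integrable \<rho> (\<lambda>y. \<phi> y * u y)" if "integrable \<rho> u" for u
      proof (rule Bochner_Integration.integrable_bound[OF that])
        show "AE y in \<rho>. norm (\<phi> y * u y) \<le> norm (u y)"
          using \<phi>(2) by (intro AE_I2) (simp add: abs_mult mult_left_le_one_le)
      qed (use that in simp)
      have "(\<integral>y. \<phi> y \<partial>mixture (\<pi> k) Q) = (\<integral>y. f y * \<phi> y \<partial>\<rho>)"
        unfolding fd using f0 by (subst integral_real_density) auto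
      moreover have "(\<integral>y. \<phi> y \<partial>mixture (\<pi> k) P) = (\<integral>y. g y * \<phi> y \<partial>\<rho>)"
        unfolding gd using g0 by (subst integral_real_density) auto
      ultimately show ?thesis using i[OF fi] i[OF gi] by (simp add: right_diff_distrib mult.commute)
    qed
    ultimately show ?thesis by (intro exI[of _ "\<lambda>y. f y - g y"]) auto
  qed
  have "\<exists>w\<in>W. (\<integral>y. \<bar>w y\<bar> \<partial>\<rho>) < c"
  proof (rule ccontr)
    assume "\<not> ?thesis"
    then have far: "c \<le> (\<integral>y. \<bar>w y\<bar> \<partial>\<rho>)" if "w \<in> W" for w using that by (meson not_le)
    have ne: "W \<noteq> {}" using ex[of 0] unfolding W_def by blast
    have int: "integrable \<rho> w" if "w \<in> W" for w using that unfolding W_def represents_def by blast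
    obtain \<phi> where \<phi>: "\<phi> \<in> borel_measurable \<rho>" "\<And>y. \<bar>\<phi> y\<bar> \<le> 1"
      and sep: "\<And>w. w \<in> W \<Longrightarrow> c / 2 \<le> (\<integral>y. \<phi> y * w y \<partial>\<rho>)"
      using L1_separation[OF \<rho>.prob_space_axioms ne int convex c far] by blast
    have \<phi>b: "\<phi> \<in> borel_measurable borel" using \<phi>(1) measurable_cong_sets[OF \<rho>s refl] by blast
    \<comment> \<open>The merging hypothesis is about functions with values in the unit interval; the two mixtures have
      equal mass, so the shift does not contribute.\<close>
    define \<psi> where "\<psi> y = (1 + \<phi> y) / 2" for y
    have \<psi>: "\<psi> \<in> borel_measurable borel" "0 \<le> \<psi> y" "\<psi> y \<le> 1" for y
      using \<phi>b \<phi>(2)[of y] unfolding \<psi>_def[abs_def] by (auto simp: abs_le_iff)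
    have "c / 4 \<le> (\<integral>y. \<psi> y \<partial>mixture (\<pi> k) Q) - (\<integral>y. \<psi> y \<partial>mixture (\<pi> k) P)" for k
    proof -
      obtain w where w: "represents w (\<pi> k)"
        and eq: "(\<integral>y. \<psi> y * w y \<partial>\<rho>) = (\<integral>y. \<psi> y \<partial>mixture (\<pi> k) Q) - (\<integral>y. \<psi> y \<partial>mixture (\<pi> k) P)"
        using ex[of k] \<psi> by blast
      then have W: "w \<in> W" and i: "integrable \<rho> w" unfolding W_def represents_def by auto
      have i\<phi>: "integrable \<rho> (\<lambda>y. \<phi> y * w y)"
      proof (rule Bochner_Integration.integrable_bound[OF i])
        show "(\<lambda>y. \<phi> y * w y) \<in> borel_measurable \<rho>" using \<phi>(1) i by simp
        show "AE y in \<rho>. norm (\<phi> y * w y) \<le> norm (w y)"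
          using \<phi>(2) by (intro AE_I2) (simp add: abs_mult mult_left_le_one_le)
      qed
      have "(\<integral>y. indicator UNIV y * w y \<partial>\<rho>) = measure (mixture (\<pi> k) Q) UNIV - measure (mixture (\<pi> k) P) UNIV"
        by (rule representsD[OF w]) simp
      moreover have "measure (mixture (\<pi> k) R) UNIV = 1" if "R \<in> borel_probs" for R
        using prob_space.prob_space[OF borel_probsD(1)[OF mixture_borel_probs[OF \<pi>[of k] that]]]
          borel_probsD(3)[OF mixture_borel_probs[OF \<pi>[of k] that]] by simp
      ultimately have "(\<integral>y. w y \<partial>\<rho>) = 0" using P Q by simp
      then have "(\<integral>y. \<psi> y * w y \<partial>\<rho>) = (\<integral>y. \<phi> y * w y \<partial>\<rho>) / 2"
        unfolding \<psi>_def using i i\<phi> by (simp add: distrib_right add_divide_distrib)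
      then show ?thesis using sep[OF W] eq by simp
    qed
    moreover have "(\<lambda>k. (\<integral>y. \<psi> y \<partial>mixture (\<pi> k) Q) - (\<integral>y. \<psi> y \<partial>mixture (\<pi> k) P)) \<longlonglongrightarrow> 0"
      using \<psi> by (intro merge)
    ultimately have "c / 4 \<le> 0" by (intro LIMSEQ_le_const) auto
    then show False using c by simp
  qed
  then obtain w \<kappa> where w: "represents w \<kappa>" and small: "(\<integral>y. \<bar>w y\<bar> \<partial>\<rho>) < c" unfolding W_def by blast
  have "\<bar>measure (mixture \<kappa> Q) A - measure (mixture \<kappa> P) A\<bar> \<le> c" if A: "A \<in> sets borel" for A
  proof -
    have i: "integrable \<rho> w" using w unfolding represents_def by blast
    have "\<bar>measure (mixture \<kappa> Q) A - measure (mixture \<kappa> P) A\<bar> = \<bar>\<integral>y. indicator A y * w y \<partial>\<rho>\<bar>"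
      unfolding representsD[OF w A] ..
    also have "\<dots> \<le> (\<integral>y. \<bar>indicator A y * w y\<bar> \<partial>\<rho>)" by (rule integral_abs_bound)
    also have "\<dots> \<le> (\<integral>y. \<bar>w y\<bar> \<partial>\<rho>)"
      using i int_ind[OF i A] by (intro integral_mono) (auto simp: indicator_def)
    finally show ?thesis using small by simp
  qed
  then show ?thesis using that w unfolding represents_def by blast
qed

text \<open>
  First \<open>K\<close> is chosen so that the excess of the log likelihood ratio of \<open>Q\<close> and \<open>P\<close> over \<open>ln K\<close> is
  small in the mean. This persists for every prior: the mixtures are images of the laws of \<open>(g, y)\<close>,
  whose likelihood ratio does not involve \<open>g\<close>. Only then is the prior chosen, so that the mixtures
  are close in total variation on the scale \<open>\<delta> / K\<^sup>2\<close>.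
\<close>
lemma small_divergence_mixture:
  fixes D :: "'y \<Rightarrow> real" and \<pi> :: "nat \<Rightarrow> 'g measure"
  assumes \<pi>: "\<And>k. \<pi> k \<in> borel_probs"
    and inv: "\<And>B g. B \<in> sets borel \<Longrightarrow>
      (\<lambda>k. \<bar>measure (\<pi> k) B - measure (\<pi> k) ((\<lambda>b. b + g) ` B)\<bar>) \<longlonglongrightarrow> 0"
    and P: "P \<in> borel_probs" and Q: "Q \<in> borel_probs" "Q = density P (\<lambda>y. ennreal (D y))"
    and agree: "agree_on_invariant_events P Q"
    and D: "D \<in> borel_measurable borel" "\<And>y. 0 \<le> D y"
    and int: "integrable Q (\<lambda>y. ln (max (D y) 1))"
    and \<delta>: "0 < \<delta>"
  obtains \<kappa> r where "\<kappa> \<in> borel_probs" "r \<in> borel_measurable borel" "\<And>y. 0 \<le> r y"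
    "mixture \<kappa> Q = density (mixture \<kappa> P) (\<lambda>y. ennreal (r y))"
    "integrable (mixture \<kappa> Q) (\<lambda>y. ln (r y))" "(\<integral>y. ln (r y) \<partial>mixture \<kappa> Q) \<le> \<delta>"
proof -
  interpret Q: prob_space Q by (rule borel_probsD[OF Q(1)])
  have DQ: "D \<in> borel_measurable Q" using D(1) measurable_cong_sets[OF borel_probsD(2)[OF Q(1)] refl] by blast
  have excess: "0 \<le> ln (max x K) - ln K" "ln (max x K) - ln K \<le> ln (max x 1)" if "1 \<le> K" for x K :: real
    using that by (auto simp: max_def)
  have int_K: "integrable Q (\<lambda>y. ln (max (D y) K))" if K: "1 \<le> K" for K
  proof (rule Bochner_Integration.integrable_bound)
    show "integrable Q (\<lambda>y. ln (max (D y) 1) + ln K)" using int by simp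
    show "(\<lambda>y. ln (max (D y) K)) \<in> borel_measurable Q" using DQ by measurable
    show "AE y in Q. norm (ln (max (D y) K)) \<le> norm (ln (max (D y) 1) + ln K)"
    proof (rule AE_I2)
      fix y
      have "0 \<le> ln K" "0 \<le> ln (max (D y) K)" using K by auto
      then show "norm (ln (max (D y) K)) \<le> norm (ln (max (D y) 1) + ln K)"
        using excess[OF K, of "D y"] by simp
    qed
  qed
  have "(\<lambda>n. \<integral>y. ln (max (D y) (real n + 2)) - ln (real n + 2) \<partial>Q) \<longlonglongrightarrow> (\<integral>y. 0 \<partial>Q)"
  proof (rule integral_dominated_convergence[where w = "\<lambda>y. ln (max (D y) 1)"])
    show "AE y in Q. (\<lambda>n. ln (max (D y) (real n + 2)) - ln (real n + 2)) \<longlonglongrightarrow> 0"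
    proof (rule AE_I2)
      fix y
      obtain n0 where "D y \<le> real n0" using real_arch_simple by blast
      then have "\<forall>\<^sub>F n in sequentially. ln (max (D y) (real n + 2)) - ln (real n + 2) = 0"
        unfolding eventually_sequentially by (intro exI[of _ n0]) (auto simp: max_def)
      then show "(\<lambda>n. ln (max (D y) (real n + 2)) - ln (real n + 2)) \<longlonglongrightarrow> 0"
        by (rule tendsto_eventually)
    qed
    show "AE y in Q. norm (ln (max (D y) (real n + 2)) - ln (real n + 2)) \<le> ln (max (D y) 1)" for n
    proof (rule AE_I2)
      fix y
      show "norm (ln (max (D y) (real n + 2)) - ln (real n + 2)) \<le> ln (max (D y) 1)"
        using excess[of "real n + 2" "D y"] by simp
    qed
    show "(\<lambda>y. ln (max (D y) (real n + 2)) - ln (real n + 2)) \<in> borel_measurable Q" for n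
      using DQ by measurable
  qed (use int in auto)
  then have "\<forall>\<^sub>F n in sequentially. (\<integral>y. ln (max (D y) (real n + 2)) - ln (real n + 2) \<partial>Q) < \<delta> / 4"
    using \<delta> by (intro order_tendstoD(2)[of _ 0]) auto
  then obtain n where n: "(\<integral>y. ln (max (D y) (real n + 2)) - ln (real n + 2) \<partial>Q) < \<delta> / 4"
    by (auto simp: eventually_sequentially)
  define K where "K = real n + 2"
  have K: "1 < K" unfolding K_def by simp
  have tail: "(\<integral>y. ln (max (D y) K) \<partial>Q) - ln K < \<delta> / 4"
    using n int_K[of K] K unfolding K_def[symmetric] by (simp add: Q.prob_space)
  define c where "c = \<delta> / (4 * K\<^sup>2)"
  have c: "0 < c" "2 * K\<^sup>2 * c = \<delta> / 2" using \<delta> K unfolding c_def by auto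
  obtain \<kappa> where \<kappa>: "\<kappa> \<in> borel_probs"
    and tv: "\<And>A. A \<in> sets borel \<Longrightarrow> \<bar>measure (mixture \<kappa> Q) A - measure (mixture \<kappa> P) A\<bar> \<le> c"
    using close_mixture_exists[OF \<pi> P Q D(1) mixtures_merge[OF \<pi> inv P Q(1) agree] c(1)] by blast
  note mP = borel_probsD[OF mixture_borel_probs[OF \<kappa> P]]
    and mQ = borel_probsD[OF mixture_borel_probs[OF \<kappa> Q(1)]]
  have "absolutely_continuous (mixture \<kappa> P) (mixture \<kappa> Q)"
    using mixture_absolutely_continuous[OF \<kappa> P _ D(1)] Q by simp
  then obtain r where "r \<in> borel_measurable (mixture \<kappa> P)" and r0: "\<And>y. 0 \<le> r y"
    and rd: "mixture \<kappa> Q = density (mixture \<kappa> P) (\<lambda>y. ennreal (r y))"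
    using real_density_exists[OF mP(1) mQ(1)] mP(2) mQ(2) by metis
  then have r: "r \<in> borel_measurable borel" "r \<in> borel_measurable (mixture \<kappa> P)"
    using measurable_cong_sets[OF mP(2) refl] by blast+
  interpret prior: prob_space \<kappa> by (rule borel_probsD[OF \<kappa>])
  let ?\<Omega> = "\<kappa> \<Otimes>\<^sub>M P" and ?D = "\<lambda>(g, y). D y" and ?T = "\<lambda>(g, y). act g y"
  have DP: "D \<in> borel_measurable P" using D(1) measurable_cong_sets[OF borel_probsD(2)[OF P] refl] by blast
  then have D\<Omega>: "?D \<in> borel_measurable ?\<Omega>" by measurable
  have T: "?T \<in> measurable ?\<Omega> borel" by (rule act_measurable_prod[OF \<kappa> P])
  have dens: "density ?\<Omega> (\<lambda>z. ennreal (?D z)) = \<kappa> \<Otimes>\<^sub>M Q"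
    using pair_measure_density_snd[OF P _ D(1), of \<kappa>] Q by (simp add: case_prod_unfold)
  have push: "distr (density ?\<Omega> (\<lambda>z. ennreal (?D z))) borel ?T = density (distr ?\<Omega> borel ?T) (\<lambda>y. ennreal (r y))"
    unfolding dens using rd unfolding mixture_def .
  have prob: "prob_space (density ?\<Omega> (\<lambda>z. ennreal (?D z)))"
    unfolding dens by (rule prob_space_pair[OF borel_probsD(1)[OF \<kappa>] borel_probsD(1)[OF Q(1)]])
  have snd: "distr (\<kappa> \<Otimes>\<^sub>M Q) Q snd = Q"
  proof (rule measure_eqI)
    fix A assume "A \<in> sets (distr (\<kappa> \<Otimes>\<^sub>M Q) Q snd)"
    then have A: "A \<in> sets Q" by simp
    have "emeasure (distr (\<kappa> \<Otimes>\<^sub>M Q) Q snd) A = emeasure (\<kappa> \<Otimes>\<^sub>M Q) (space \<kappa> \<times> A)"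
      using A sets.sets_into_space[OF A]
      by (subst emeasure_distr) (auto simp: space_pair_measure intro!: arg_cong2[where f = emeasure])
    also have "\<dots> = emeasure Q A"
      using A by (subst Q.emeasure_pair_measure_Times) (auto simp: prior.emeasure_space_1)
    finally show "emeasure (distr (\<kappa> \<Otimes>\<^sub>M Q) Q snd) A = emeasure Q A" .
  qed simp
  have lnD: "integrable (\<kappa> \<Otimes>\<^sub>M Q) (\<lambda>z. ln (max (?D z) K))"
    "(\<integral>z. ln (max (?D z) K) \<partial>(\<kappa> \<Otimes>\<^sub>M Q)) = (\<integral>y. ln (max (D y) K) \<partial>Q)"
  proof -
    have m: "(\<lambda>y. ln (max (D y) K)) \<in> borel_measurable Q" using DQ by measurable
    show "integrable (\<kappa> \<Otimes>\<^sub>M Q) (\<lambda>z. ln (max (?D z) K))"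
      using integrable_distr[OF measurable_snd, of \<kappa> Q "\<lambda>y. ln (max (D y) K)"] int_K[of K] K
      unfolding snd by (simp add: case_prod_unfold)
    show "(\<integral>z. ln (max (?D z) K) \<partial>(\<kappa> \<Otimes>\<^sub>M Q)) = (\<integral>y. ln (max (D y) K) \<partial>Q)"
      using integral_distr[OF measurable_snd m, of \<kappa>] unfolding snd by (simp add: case_prod_unfold)
  qed
  note ln_push = ln_likelihood_ratio_pushforward[OF D\<Omega> prob T r(1) _ r0 push, of K]
  have "integrable (\<kappa> \<Otimes>\<^sub>M Q) (\<lambda>z. ln (max (r (?T z)) K))"
    and le: "(\<integral>z. ln (max (r (?T z)) K) \<partial>(\<kappa> \<Otimes>\<^sub>M Q)) \<le> (\<integral>y. ln (max (D y) K) \<partial>Q)"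
    using ln_push(1) ln_push(2) lnD D(2) K unfolding dens by (auto simp: case_prod_unfold)
  moreover have TQ: "?T \<in> measurable (\<kappa> \<Otimes>\<^sub>M Q) borel" by (rule act_measurable_prod[OF \<kappa> Q(1)])
  moreover have rm: "(\<lambda>y. ln (max (r y) K)) \<in> borel_measurable borel" using r(1) by measurable
  ultimately have int_r: "integrable (mixture \<kappa> Q) (\<lambda>y. ln (max (r y) K))"
    unfolding mixture_def by (subst integrable_distr_eq) auto
  have "(\<integral>y. ln (max (r y) K) \<partial>mixture \<kappa> Q) \<le> (\<integral>y. ln (max (D y) K) \<partial>Q)"
    using le integral_distr[OF TQ rm] unfolding mixture_def by simp
  then have "(\<integral>y. ln (max (r y) K) \<partial>mixture \<kappa> Q) - ln K \<le> \<delta> / 4" using tail by simp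
  moreover have "integrable (mixture \<kappa> Q) (\<lambda>y. ln (r y))"
    and "(\<integral>y. ln (r y) \<partial>mixture \<kappa> Q) \<le> 2 * K\<^sup>2 * c + 2 * ((\<integral>y. ln (max (r y) K) \<partial>mixture \<kappa> Q) - ln K)"
    using expected_ln_density_le[OF mP(1) r(2) r0 _ _ K, of c] mQ(1) tv int_r mP(2)
    unfolding rd[symmetric] by auto
  ultimately show ?thesis using that[OF \<kappa> r(1) r0 rd] c(2) by auto
qed

end

section \<open>The divergence of the mixtures and of the maximal invariants\<close>

lemma KL_density_eq:
  fixes D :: "'a \<Rightarrow> real"
  assumes P: "prob_space P" and D[measurable]: "D \<in> borel_measurable P" and nn: "\<And>x. x \<in> space P \<Longrightarrow> 0 \<le> D x"
    and Q: "Q = density P (\<lambda>x. ennreal (D x))"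
  shows "KL Q P = (if integrable Q (\<lambda>x. ln (D x)) then ereal (\<integral>x. ln (D x) \<partial>Q) else \<infinity>)"
proof -
  interpret P: prob_space P by fact
  have Qs: "sets Q = sets P" unfolding Q by simp
  have ac: "absolutely_continuous P Q"
    unfolding Q by (rule absolutely_continuousI_density) measurable
  have "density P (RN_deriv P Q) = density P (\<lambda>x. ennreal (D x))"
    using P.density_RN_deriv[OF ac Qs] Q by simp
  then have "AE x in P. RN_deriv P Q x = ennreal (D x)"
    by (intro P.density_unique) auto
  then have "AE x in P. entropy_density (exp 1) P Q x = ln (D x)"
    using AE_space
    by eventually_elim (simp add: entropy_density_def log_def nn)
  then have eq: "AE x in Q. entropy_density (exp 1) P Q x = ln (D x)"
    unfolding Q by (subst AE_density) auto
  have m[measurable]: "entropy_density (exp 1) P Q \<in> borel_measurable Q" "(\<lambda>x. ln (D x)) \<in> borel_measurable Q"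
    unfolding measurable_cong_sets[OF Qs refl] by (rule measurable_entropy_density, measurable)
  have "integrable Q (entropy_density (exp 1) P Q) \<longleftrightarrow> integrable Q (\<lambda>x. ln (D x))"
    using eq m by (intro integrable_cong_AE) auto
  moreover have "KL_divergence (exp 1) P Q = (\<integral>x. ln (D x) \<partial>Q)"
    unfolding KL_divergence_def using eq m by (intro integral_cong_AE) auto
  ultimately show ?thesis using ac unfolding KL_def by simp
qed

lemma integrable_of_moment:
  fixes f :: "'a \<Rightarrow> real"
  assumes M: "prob_space M" and f[measurable]: "f \<in> borel_measurable M" and e: "0 < e"
    and mom: "(\<integral>\<^sup>+x. ennreal (\<bar>f x\<bar> powr (1 + e)) \<partial>M) < \<infinity>"
  shows "integrable M f"
proof -
  interpret prob_space M by fact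
  have "integrable M (\<lambda>x. \<bar>f x\<bar> powr (1 + e))" using mom by (intro integrableI_nonneg) auto
  then have i: "integrable M (\<lambda>x. 1 + \<bar>f x\<bar> powr (1 + e))" by simp
  have le: "\<bar>y\<bar> \<le> 1 + \<bar>y\<bar> powr (1 + e)" for y :: real
  proof (cases "\<bar>y\<bar> \<le> 1")
    case False
    then have "\<bar>y\<bar> powr 1 \<le> \<bar>y\<bar> powr (1 + e)" using e by (intro powr_mono) auto
    then show ?thesis using False by simp
  qed (simp add: add_increasing2)
  show ?thesis
    by (rule Bochner_Integration.integrable_bound[OF i]) (use le in \<open>auto simp: add_nonneg_nonneg\<close>)
qed

theorem theorem2:
  fixes act :: "'g::{topological_group_add, polish_space} \<Rightarrow> 'x::polish_space \<Rightarrow> 'x"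
    and act_n :: "'g \<Rightarrow> ('n::finite \<Rightarrow> 'x) \<Rightarrow> ('n \<Rightarrow> 'x)"
    and P Q :: "'g \<Rightarrow> ('n \<Rightarrow> 'x) measure"
    and \<mu> :: "('n \<Rightarrow> 'x) measure"
    and chi :: "'g \<Rightarrow> real"
    and p q :: "'g \<Rightarrow> ('n \<Rightarrow> 'x) \<Rightarrow> real"
    and S :: "('n \<Rightarrow> 'x) set"
    and m :: "('n \<Rightarrow> 'x) \<Rightarrow> 'm"
    and N \<nu> :: "'m measure"
    and pM qM :: "'m \<Rightarrow> real"
    and \<epsilon> :: real
  assumes "is_action act"
    and "act_n = componentwise act"
    and "amenable TYPE('g)"
    and "locally compact (UNIV :: 'g set)"
    and "locally compact (UNIV :: ('n \<Rightarrow> 'x) set)"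
    and "free_action act_n"
    and "continuous_action act_n"
    and "proper_action act_n"
    and "\<And>g. P g \<in> space (prob_algebra borel)"
    and "\<And>g. Q g \<in> space (prob_algebra borel)"
    and "invariant_model act_n P"
    and "invariant_model act_n Q"
    and "sets \<mu> = sets borel"
    and "relatively_left_invariant act_n chi \<mu>"
    and "\<And>g. has_density (P g) \<mu> (p g)"
    and "\<And>g. has_density (Q g) \<mu> (q g)"
    and "\<And>g. {x. p g x > 0} = S"
    and "\<And>g. {x. q g x > 0} = S"
    and "m \<in> measurable borel N"
    and "maximally_invariant act_n m"
    and "captures_invariant_events act_n m N"
    and "sets \<nu> = sets N"
    and "has_density (distr (P 0) N m) \<nu> pM"
    and "has_density (distr (Q 0) N m) \<nu> qM"
    and "\<epsilon> > 0"
    and "(\<integral>\<^sup>+ x. ennreal (\<bar>ln (q 0 x / p 0 x)\<bar> powr (1 + \<epsilon>)) \<partial>Q 0) < \<infinity>"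
    and "(\<integral>\<^sup>+ t. ennreal (\<bar>ln (qM t / pM t)\<bar> powr (1 + \<epsilon>)) \<partial>distr (Q 0) N m) < \<infinity>"
  shows "(INF (\<pi>\<^sub>0, \<pi>\<^sub>1) \<in> space (prob_algebra borel) \<times> space (prob_algebra borel).
            KL (\<pi>\<^sub>1 \<bind> Q) (\<pi>\<^sub>0 \<bind> P)) = KL (distr (Q 0) N m) (distr (P 0) N m)"
proof -
  have "is_action act_n"
    using assms(1) unfolding assms(2) is_action_def componentwise_def by auto
  then interpret free_proper_action act_n
    using assms(6-8) by (intro free_proper_action.intro)
  have P: "P g \<in> borel_probs" and Q: "Q g \<in> borel_probs" for g
    using assms(9,10) by (auto simp: borel_probs_def)
  note PD = borel_probsD[OF P] and QD = borel_probsD[OF Q]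
  interpret P0: prob_space "P 0" by (rule PD)
  interpret Q0: prob_space "Q 0" by (rule QD)
  note m = assms(19)
  have mP: "m \<in> measurable (P 0) N" and mQ: "m \<in> measurable (Q 0) N"
    using m measurable_cong_sets[OF PD(2) refl] measurable_cong_sets[OF QD(2) refl] by blast+
  have m_inv: "m (act_n g y) = m y" for g y
    using assms(20) unfolding maximally_invariant_def by blast
  let ?PM = "distr (P 0) N m" and ?QM = "distr (Q 0) N m"
  have PM: "prob_space ?PM" and QM: "prob_space ?QM"
    using mP mQ by (auto intro: P0.prob_space_distr Q0.prob_space_distr)

  define D where "D y = q 0 y / p 0 y" for y
  have dens: "p 0 \<in> borel_measurable \<mu>" "q 0 \<in> borel_measurable \<mu>" "\<And>y. 0 \<le> p 0 y" "\<And>y. 0 \<le> q 0 y"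
    "P 0 = density \<mu> (\<lambda>y. ennreal (p 0 y))" "Q 0 = density \<mu> (\<lambda>y. ennreal (q 0 y))"
    using assms(15)[of 0] assms(16)[of 0] sets_eq_imp_space_eq[OF assms(13)]
    unfolding has_density_def by auto
  have support: "p 0 y = 0 \<Longrightarrow> q 0 y = 0" for y
    using assms(17,18)[of 0] dens(3,4)[of y] by (metis less_le mem_Collect_eq)
  have Q0_D: "Q 0 = density (P 0) (\<lambda>y. ennreal (D y))"
    unfolding dens(5,6) D_def using dens(1-4) support
    by (intro density_density_divide[symmetric]) auto
  have D_meas: "D \<in> borel_measurable borel"
  proof -
    have "p 0 \<in> borel_measurable borel" "q 0 \<in> borel_measurable borel"
      using dens(1,2) measurable_cong_sets[OF assms(13) refl] by blast+
    then show ?thesis unfolding D_def[abs_def] by measurable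
  qed
  have D0: "0 \<le> D y" for y unfolding D_def using dens by simp
  have D_P: "D \<in> borel_measurable (P 0)"
    using D_meas measurable_cong_sets[OF PD(2) refl] by blast

  have \<nu>: "sets \<nu> = sets N" "space \<nu> = space N"
    using assms(22) sets_eq_imp_space_eq by auto
  have densM: "pM \<in> borel_measurable N" "qM \<in> borel_measurable N"
    "\<And>t. t \<in> space N \<Longrightarrow> 0 \<le> pM t" "\<And>t. t \<in> space N \<Longrightarrow> 0 \<le> qM t"
    "?PM = density \<nu> (\<lambda>t. ennreal (pM t))" "?QM = density \<nu> (\<lambda>t. ennreal (qM t))"
    using assms(23,24) \<nu> measurable_cong_sets[OF \<nu>(1) refl] unfolding has_density_def by auto
  have densM': "pM \<in> borel_measurable \<nu>" "qM \<in> borel_measurable \<nu>"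
    using densM(1,2) measurable_cong_sets[OF \<nu>(1) refl] by blast+
  \<comment> \<open>The densities are nonnegative on \<open>space \<nu>\<close> only, hence the maximum.\<close>
  define R where "R t = max 0 (qM t / pM t)" for t
  have R_meas[measurable]: "R \<in> borel_measurable N"
    unfolding R_def[abs_def] using densM(1,2) by measurable
  have R0: "0 \<le> R t" for t unfolding R_def by simp
  have R_eq: "R t = qM t / pM t" if "t \<in> space N" for t
    unfolding R_def using densM(3,4)[OF that] by simp
  \<comment> \<open>Where \<open>pM\<close> vanishes, the quotient has the default value \<open>0\<close>; by the support condition \<open>qM\<close>
    vanishes there as well, almost everywhere.\<close>
  have acM: "absolutely_continuous ?PM ?QM"
    unfolding Q0_D by (rule absolutely_continuous_distr_density[OF mP]) (use D_P in simp)
  have QM_R: "?QM = density ?PM (\<lambda>t. ennreal (R t))"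
  proof -
    let ?Z = "{t \<in> space \<nu>. pM t = 0}"
    have Z: "?Z \<in> sets \<nu>" using densM' by measurable
    have "emeasure ?PM ?Z = (\<integral>\<^sup>+t. ennreal (pM t) * indicator ?Z t \<partial>\<nu>)"
      unfolding densM(5) using densM' Z by (intro emeasure_density) auto
    also have "\<dots> = (\<integral>\<^sup>+t. 0 \<partial>\<nu>)" by (intro nn_integral_cong) (auto simp: indicator_def)
    finally have "?Z \<in> null_sets ?PM" using Z \<nu> by (simp add: null_sets_def)
    then have "emeasure ?QM ?Z = 0" using acM unfolding absolutely_continuous_def by blast
    then have "(\<integral>\<^sup>+t. ennreal (qM t) * indicator ?Z t \<partial>\<nu>) = 0"
      unfolding densM(6) using densM' Z by (subst (asm) emeasure_density) auto
    then have "AE t in \<nu>. ennreal (qM t) * indicator ?Z t = 0"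
      using densM' Z by (subst (asm) nn_integral_0_iff_AE) auto
    then have ac: "AE t in \<nu>. pM t = 0 \<longrightarrow> qM t = 0"
      using AE_space
    proof eventually_elim
      case (elim t)
      then show ?case using densM(4)[of t] \<nu> by (auto simp: indicator_def ennreal_eq_0_iff)
    qed
    have "?QM = density ?PM (\<lambda>t. ennreal (qM t / pM t))"
      unfolding densM(5,6) using densM' densM(3,4) ac \<nu>
      by (intro density_density_divide[symmetric]) (auto intro!: AE_I2)
    also have "\<dots> = density ?PM (\<lambda>t. ennreal (R t))"
      using R_meas densM(1,2) R_eq by (intro density_cong) (auto intro!: AE_I2)
    finally show ?thesis .
  qed
  have int_lnR: "integrable ?QM (\<lambda>t. ln (R t))"
  proof (rule integrable_of_moment[OF QM _ \<open>\<epsilon> > 0\<close>])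
    have "(\<integral>\<^sup>+t. ennreal (\<bar>ln (R t)\<bar> powr (1 + \<epsilon>)) \<partial>?QM)
        = (\<integral>\<^sup>+t. ennreal (\<bar>ln (qM t / pM t)\<bar> powr (1 + \<epsilon>)) \<partial>?QM)"
      by (intro nn_integral_cong) (simp add: R_eq)
    then show "(\<integral>\<^sup>+t. ennreal (\<bar>ln (R t)\<bar> powr (1 + \<epsilon>)) \<partial>?QM) < \<infinity>" using assms(27) by simp
  qed measurable
  have KL_M: "KL ?QM ?PM = ereal (\<integral>t. ln (R t) \<partial>?QM)"
    using KL_density_eq[OF PM _ _ QM_R] R0 int_lnR by simp

  have lower: "KL ?QM ?PM \<le> KL (\<pi>\<^sub>1 \<bind> Q) (\<pi>\<^sub>0 \<bind> P)"
    if \<pi>: "\<pi>\<^sub>0 \<in> borel_probs" "\<pi>\<^sub>1 \<in> borel_probs" for \<pi>\<^sub>0 \<pi>\<^sub>1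
  proof (cases "KL (\<pi>\<^sub>1 \<bind> Q) (\<pi>\<^sub>0 \<bind> P) = \<infinity>")
    case False
    let ?MP = "mixture \<pi>\<^sub>0 (P 0)" and ?MQ = "mixture \<pi>\<^sub>1 (Q 0)"
    have bindP: "\<pi>\<^sub>0 \<bind> P = ?MP" and bindQ: "\<pi>\<^sub>1 \<bind> Q = ?MQ"
      by (rule bind_eq_mixture[OF \<pi>(1) P assms(11)], rule bind_eq_mixture[OF \<pi>(2) Q assms(12)])
    note MP = borel_probsD[OF mixture_borel_probs[OF \<pi>(1) P[of 0]]]
      and MQ = borel_probsD[OF mixture_borel_probs[OF \<pi>(2) Q[of 0]]]
    have "absolutely_continuous ?MP ?MQ"
      using False unfolding bindP bindQ KL_def by (auto split: if_splits)
    then obtain f where f: "f \<in> borel_measurable ?MP" "\<And>y. 0 \<le> f y"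
      and fd: "?MQ = density ?MP (\<lambda>y. ennreal (f y))"
      using real_density_exists[OF MP(1) MQ(1)] MP(2) MQ(2) by metis
    have KL_f: "KL ?MQ ?MP = (if integrable ?MQ (\<lambda>y. ln (f y)) then ereal (\<integral>y. ln (f y) \<partial>?MQ) else \<infinity>)"
      using KL_density_eq[OF MP(1) f(1) _ fd] f(2) by simp
    then have int_f: "integrable ?MQ (\<lambda>y. ln (f y))"
      using False unfolding bindP bindQ by (auto split: if_splits)
    have mMP: "m \<in> measurable ?MP N" and mMQ: "m \<in> measurable ?MQ N"
      using m measurable_cong_sets[OF MP(2) refl] measurable_cong_sets[OF MQ(2) refl] by blast+
    have distrQ: "distr ?MQ N m = ?QM" and distrP: "distr ?MP N m = ?PM"
      by (rule distr_mixture_invariant[OF \<pi>(2) Q m m_inv], rule distr_mixture_invariant[OF \<pi>(1) P m m_inv])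
    have push: "distr (density ?MP (\<lambda>y. ennreal (f y))) N m = density (distr ?MP N m) (\<lambda>t. ennreal (R t))"
      unfolding fd[symmetric] distrQ distrP by (rule QM_R)
    have lnR: "integrable ?MQ (\<lambda>y. ln (R (m y)))" "(\<integral>y. ln (R (m y)) \<partial>?MQ) = (\<integral>t. ln (R t) \<partial>?QM)"
    proof -
      have ln_meas: "(\<lambda>t. ln (R t)) \<in> borel_measurable N" by measurable
      then show "integrable ?MQ (\<lambda>y. ln (R (m y)))" "(\<integral>y. ln (R (m y)) \<partial>?MQ) = (\<integral>t. ln (R t) \<partial>?QM)"
        using int_lnR integrable_distr_eq[OF mMQ ln_meas] integral_distr[OF mMQ ln_meas] unfolding distrQ[symmetric] by auto
    qed
    have "(\<integral>t. ln (R t) \<partial>?QM) \<le> (\<integral>y. ln (f y) \<partial>?MQ)"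
      using ln_likelihood_ratio_pushforward(2)[OF f(1) _ mMP R_meas f(2) R0 push, of 0] MQ(1) int_f lnR
      unfolding fd[symmetric] by (simp add: max_absorb1 f(2) R0)
    then show ?thesis unfolding bindP bindQ KL_M KL_f using int_f by simp
  qed simp

  \<comment> \<open>The measure \<open>P'\<close> of the upper bound: \<open>P 0\<close>, corrected to have the same law of \<open>m\<close> as \<open>Q 0\<close>.\<close>
  define F where "F y = R (m y)" for y
  have F_meas: "F \<in> borel_measurable borel" unfolding F_def[abs_def] by (rule measurable_compose[OF m R_meas])
  then have F_P: "F \<in> borel_measurable (P 0)" using measurable_cong_sets[OF PD(2) refl] by blast
  have F0: "0 \<le> F y" for y unfolding F_def by (rule R0)
  have F_inv: "F (act_n g y) = F y" for g y unfolding F_def by (simp add: m_inv)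
  let ?P' = "density (P 0) (\<lambda>y. ennreal (F y))"
  have P'_inv: "emeasure ?P' (m -` A) = emeasure (Q 0) (m -` A)" if A: "A \<in> sets N" for A
  proof -
    have pre: "m -` A \<in> sets (P 0)" using measurable_sets[OF mP A] PD(3) by simp
    have "emeasure ?P' (m -` A) = (\<integral>\<^sup>+y. ennreal (F y) * indicator (m -` A) y \<partial>P 0)"
      using F_P pre by (intro emeasure_density) auto
    also have "\<dots> = (\<integral>\<^sup>+y. ennreal (R (m y)) * indicator A (m y) \<partial>P 0)"
      by (simp add: F_def indicator_def)
    also have "\<dots> = (\<integral>\<^sup>+t. ennreal (R t) * indicator A t \<partial>?PM)"
      using A mP by (subst nn_integral_distr) auto
    also have "\<dots> = emeasure (density ?PM (\<lambda>t. ennreal (R t))) A"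
      using A by (intro emeasure_density[symmetric]) auto
    also have "\<dots> = emeasure (Q 0) (m -` A)"
      unfolding QM_R[symmetric] using emeasure_distr[OF mQ A] QD(3) by simp
    finally show ?thesis .
  qed
  have P': "?P' \<in> borel_probs"
  proof (rule borel_probsI)
    have "m -` space N = UNIV" using measurable_space[OF m] by auto
    then have "emeasure ?P' UNIV = 1"
      using P'_inv[OF sets.top] Q0.emeasure_space_1 QD(3) by simp
    then show "prob_space ?P'" using PD(3) by (intro prob_spaceI) simp
  qed (simp add: PD)
  have agree: "agree_on_invariant_events ?P' (Q 0)"
    unfolding agree_on_invariant_events_def
  proof (intro ballI impI)
    fix B assume "B \<in> sets borel" "\<forall>g. act_n g ` B = B"
    then obtain A where "A \<in> sets N" "B = m -` A"
      using assms(21) unfolding captures_invariant_events_def by blast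
    then show "emeasure ?P' B = emeasure (Q 0) B" using P'_inv by simp
  qed
  have Fpos: "AE y in Q 0. 0 < F y"
  proof -
    have "AE t in ?QM. 0 < R t" unfolding QM_R using R0 by (subst AE_density) (auto simp: less_le)
    then show ?thesis unfolding F_def using mQ by (subst (asm) AE_distr_iff) auto
  qed
  have Dpos: "AE y in Q 0. 0 < D y"
    unfolding Q0_D using D_P D0 by (subst AE_density) (auto simp: less_le)
  have "AE y in P 0. F y = 0 \<longrightarrow> D y = 0"
  proof -
    have "AE y in P 0. 0 < ennreal (D y) \<longrightarrow> 0 < F y"
      using Fpos D_P unfolding Q0_D by (subst (asm) AE_density) auto
    then show ?thesis
    proof eventually_elim
      case (elim y)
      then show ?case using D0[of y] by (auto simp: less_le)
    qed
  qed
  then have Q0_DF: "Q 0 = density ?P' (\<lambda>y. ennreal (D y / F y))"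
    unfolding Q0_D using F_P D_P F0 D0 by (intro density_density_divide[symmetric]) auto
  have DQ: "D \<in> borel_measurable (Q 0)" "F \<in> borel_measurable (Q 0)"
    using D_meas F_meas measurable_cong_sets[OF QD(2) refl] by blast+
  have int_lnD: "integrable (Q 0) (\<lambda>y. ln (D y))"
    using assms(26) DQ unfolding D_def by (intro integrable_of_moment[OF QD(1) _ \<open>\<epsilon> > 0\<close>]) auto
  have int_lnF: "integrable (Q 0) (\<lambda>y. ln (F y))"
    unfolding F_def using int_lnR mQ by (subst (asm) integrable_distr_eq) auto
  have int_DF: "integrable (Q 0) (\<lambda>y. ln (max (D y / F y) 1))"
  proof (rule Bochner_Integration.integrable_bound)
    show "integrable (Q 0) (\<lambda>y. \<bar>ln (D y)\<bar> + \<bar>ln (F y)\<bar>)" using int_lnD int_lnF by auto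
    show "(\<lambda>y. ln (max (D y / F y) 1)) \<in> borel_measurable (Q 0)" using DQ by measurable
    show "AE y in Q 0. norm (ln (max (D y / F y) 1)) \<le> norm (\<bar>ln (D y)\<bar> + \<bar>ln (F y)\<bar>)"
      using Dpos Fpos by eventually_elim (auto simp: max_def ln_div)
  qed

  obtain \<pi> :: "nat \<Rightarrow> 'g measure" where \<pi>: "\<And>k. \<pi> k \<in> borel_probs"
    and \<pi>_inv: "\<And>B g. B \<in> sets borel \<Longrightarrow>
      (\<lambda>k. \<bar>measure (\<pi> k) B - measure (\<pi> k) ((\<lambda>b. b + g) ` B)\<bar>) \<longlonglongrightarrow> 0"
    using assms(3) unfolding amenable_def borel_probs_def by blast
  have upper: "\<exists>\<kappa>\<in>borel_probs. KL (\<kappa> \<bind> Q) (\<kappa> \<bind> P) \<le> KL ?QM ?PM + ereal \<delta>" if \<delta>: "0 < \<delta>" for \<delta>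
  proof -
    have DF: "(\<lambda>y. D y / F y) \<in> borel_measurable borel" "0 \<le> D y / F y" for y
      using D_meas F_meas D0 F0 by auto
    obtain \<kappa> r where \<kappa>: "\<kappa> \<in> borel_probs" and r: "r \<in> borel_measurable borel" "\<And>y. 0 \<le> r y"
      and rd: "mixture \<kappa> (Q 0) = density (mixture \<kappa> ?P') (\<lambda>y. ennreal (r y))"
      and int_r: "integrable (mixture \<kappa> (Q 0)) (\<lambda>y. ln (r y))"
      and small: "(\<integral>y. ln (r y) \<partial>mixture \<kappa> (Q 0)) \<le> \<delta>"
      using small_divergence_mixture[OF \<pi> \<pi>_inv P' Q Q0_DF agree DF int_DF \<delta>] by blast
    let ?MP = "mixture \<kappa> (P 0)" and ?MQ = "mixture \<kappa> (Q 0)"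
    note MP = borel_probsD[OF mixture_borel_probs[OF \<kappa> P[of 0]]]
      and MQ = borel_probsD[OF mixture_borel_probs[OF \<kappa> Q[of 0]]]
    have rF: "r \<in> borel_measurable ?MP" "F \<in> borel_measurable ?MP"
      "r \<in> borel_measurable ?MQ" "F \<in> borel_measurable ?MQ"
      using r(1) F_meas measurable_cong_sets[OF MP(2) refl] measurable_cong_sets[OF MQ(2) refl] by blast+
    have "?MQ = density (density ?MP (\<lambda>y. ennreal (F y))) (\<lambda>y. ennreal (r y))"
      unfolding rd using F_meas F_inv by (subst mixture_invariant_density[OF \<kappa> P P']) auto
    also have "\<dots> = density ?MP (\<lambda>y. ennreal (F y) * ennreal (r y))"
      using rF by (intro density_density_eq) auto
    finally have Fr: "?MQ = density ?MP (\<lambda>y. ennreal (F y * r y))"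
      using F0 r(2) by (simp add: ennreal_mult)
    have "AE y in ?MQ. 0 < F y * r y"
      unfolding Fr using rF F0 r(2) by (subst AE_density) (auto simp: ennreal_zero_less_mult_iff)
    then have ln_split: "AE y in ?MQ. ln (F y * r y) = ln (F y) + ln (r y)"
    proof eventually_elim
      case (elim y)
      then have "F y \<noteq> 0" "r y \<noteq> 0" by auto
      then have "0 < F y" "0 < r y" using F0[of y] r(2)[of y] by auto
      then show ?case by (rule ln_mult_pos)
    qed
    have mMQ: "m \<in> measurable ?MQ N"
      using m measurable_cong_sets[OF MQ(2) refl] by blast
    have distrQ: "distr ?MQ N m = ?QM"
      by (rule distr_mixture_invariant[OF \<kappa> Q m m_inv])
    have lnF: "integrable ?MQ (\<lambda>y. ln (F y))" "(\<integral>y. ln (F y) \<partial>?MQ) = (\<integral>t. ln (R t) \<partial>?QM)"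
    proof -
      have ln_meas: "(\<lambda>t. ln (R t)) \<in> borel_measurable N" by measurable
      then show "integrable ?MQ (\<lambda>y. ln (F y))" "(\<integral>y. ln (F y) \<partial>?MQ) = (\<integral>t. ln (R t) \<partial>?QM)"
        using int_lnR integrable_distr_eq[OF mMQ ln_meas] integral_distr[OF mMQ ln_meas]
        unfolding distrQ[symmetric] F_def by auto
    qed
    have int_sum: "integrable ?MQ (\<lambda>y. ln (F y) + ln (r y))" using lnF(1) int_r by simp
    have int_Fr: "integrable ?MQ (\<lambda>y. ln (F y * r y))"
      using ln_split rF int_sum by (subst integrable_cong_AE[OF _ _ ln_split]) auto
    have "KL ?MQ ?MP = ereal (\<integral>y. ln (F y * r y) \<partial>?MQ)"
      using KL_density_eq[OF MP(1) _ _ Fr] rF F0 r(2) int_Fr by simp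
    also have "(\<integral>y. ln (F y * r y) \<partial>?MQ) = (\<integral>y. ln (F y) + ln (r y) \<partial>?MQ)"
      using rF by (intro integral_cong_AE ln_split) auto
    also have "\<dots> = (\<integral>t. ln (R t) \<partial>?QM) + (\<integral>y. ln (r y) \<partial>?MQ)"
      using lnF int_r by simp
    finally have "KL ?MQ ?MP \<le> KL ?QM ?PM + ereal \<delta>"
      unfolding KL_M using small by simp
    moreover have "\<kappa> \<bind> P = ?MP" "\<kappa> \<bind> Q = ?MQ"
      by (rule bind_eq_mixture[OF \<kappa> P assms(11)], rule bind_eq_mixture[OF \<kappa> Q assms(12)])
    ultimately show ?thesis using \<kappa> by (intro bexI[of _ \<kappa>]) simp_all
  qed

  show ?thesis
    unfolding borel_probs_def[symmetric]
  proof (rule antisym)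
    show "(INF (\<pi>\<^sub>0, \<pi>\<^sub>1) \<in> borel_probs \<times> borel_probs. KL (\<pi>\<^sub>1 \<bind> Q) (\<pi>\<^sub>0 \<bind> P)) \<le> KL ?QM ?PM"
    proof (rule ereal_le_epsilon2)
      fix \<delta> :: real assume "0 < \<delta>"
      then obtain \<kappa> where \<kappa>: "\<kappa> \<in> borel_probs" "KL (\<kappa> \<bind> Q) (\<kappa> \<bind> P) \<le> KL ?QM ?PM + ereal \<delta>"
        using upper by blast
      have "(INF (\<pi>\<^sub>0, \<pi>\<^sub>1) \<in> borel_probs \<times> borel_probs. KL (\<pi>\<^sub>1 \<bind> Q) (\<pi>\<^sub>0 \<bind> P)) \<le> KL (\<kappa> \<bind> Q) (\<kappa> \<bind> P)"
        using \<kappa>(1) by (intro INF_lower2[of "(\<kappa>, \<kappa>)"]) auto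
      then show "(INF (\<pi>\<^sub>0, \<pi>\<^sub>1) \<in> borel_probs \<times> borel_probs. KL (\<pi>\<^sub>1 \<bind> Q) (\<pi>\<^sub>0 \<bind> P)) \<le> KL ?QM ?PM + ereal \<delta>"
        using \<kappa>(2) by (rule order_trans)
    qed
    show "KL ?QM ?PM \<le> (INF (\<pi>\<^sub>0, \<pi>\<^sub>1) \<in> borel_probs \<times> borel_probs. KL (\<pi>\<^sub>1 \<bind> Q) (\<pi>\<^sub>0 \<bind> P))"
      using lower by (intro INF_greatest) auto
  qed
qed

end
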